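(* Let $s>-1$ be real and let $\varphi$ be an automorphism of the unit disk $D$ that is not a rotation (i.e. not of the form $z\mapsto\lambda z$ with $|\lambda|=1$). Then the composition operator $C_\varphi$ is not essentially normal on $A^2_s(D)$.
   Context: $D$ is the open unit disk in $\mathbb{C}$ and $dA$ is Lebesgue area measure. For real $s>-1$, $A^2_s(D)$ is the Hilbert space of holomorphic $f$ on $D$ with $\|f\|_s^2=\int_D|f(z)|^2\frac{s+1}{\pi}(1-|z|^2)^s\,dA(z)<\infty$. $C_\varphi f=f\circ\varphi$. A bounded operator $T$ on a Hilbert space is essentially normal if its self-commutator $T^*T-TT^*$ is compact. *)

theory Defs
  imports "HOL-Complex_Analysis.Complex_Analysis"
begin

text \<open>Weighted Bergman space A^2_s(D). Elements are represented by functions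
  complex => complex that are holomorphic on the unit disk and vanish outside it
  (canonical representatives).\<close>

definition bergman_weight :: "real \<Rightarrow> complex \<Rightarrow> real" where
  "bergman_weight s z = (s + 1) / pi * (1 - (cmod z)\<^sup>2) powr s"

definition bergman_norm2 :: "real \<Rightarrow> (complex \<Rightarrow> complex) \<Rightarrow> real" where
  "bergman_norm2 s f =
     (LINT z : ball 0 1 | lborel. (cmod (f z))\<^sup>2 * bergman_weight s z)"

definition bergman_inner :: "real \<Rightarrow> (complex \<Rightarrow> complex) \<Rightarrow> (complex \<Rightarrow> complex) \<Rightarrow> complex" where
  "bergman_inner s f g =
     (LINT z : ball 0 1 | lborel. f z * cnj (g z) * complex_of_real (bergman_weight s z))"

definition A2 :: "real \<Rightarrow> (complex \<Rightarrow> complex) set" where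
  "A2 s = {f. f holomorphic_on ball 0 1 \<and> (\<forall>z. z \<notin> ball 0 1 \<longrightarrow> f z = 0) \<and>
              set_integrable lborel (ball 0 1) (\<lambda>z. (cmod (f z))\<^sup>2 * bergman_weight s z)}"

definition comp_op :: "(complex \<Rightarrow> complex) \<Rightarrow> (complex \<Rightarrow> complex) \<Rightarrow> (complex \<Rightarrow> complex)" where
  "comp_op \<phi> f = (\<lambda>z. if z \<in> ball 0 1 then f (\<phi> z) else 0)"

definition is_adjoint :: "real \<Rightarrow> ((complex \<Rightarrow> complex) \<Rightarrow> (complex \<Rightarrow> complex))
    \<Rightarrow> ((complex \<Rightarrow> complex) \<Rightarrow> (complex \<Rightarrow> complex)) \<Rightarrow> bool" where
  "is_adjoint s T S \<longleftrightarrow> (\<forall>g\<in>A2 s. S g \<in> A2 s) \<and>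
     (\<forall>f\<in>A2 s. \<forall>g\<in>A2 s. bergman_inner s (T f) g = bergman_inner s f (S g))"

definition compact_op :: "real \<Rightarrow> ((complex \<Rightarrow> complex) \<Rightarrow> (complex \<Rightarrow> complex)) \<Rightarrow> bool" where
  "compact_op s K \<longleftrightarrow> (\<forall>fs :: nat \<Rightarrow> complex \<Rightarrow> complex. (\<forall>n. fs n \<in> A2 s) \<and> (\<exists>B. \<forall>n. bergman_norm2 s (fs n) \<le> B) \<longrightarrow>
      (\<exists>r g. strict_mono r \<and> g \<in> A2 s \<and>
         (\<lambda>n. bergman_norm2 s (K (fs (r n)) - g)) \<longlonglongrightarrow> 0))"

definition bounded_op :: "real \<Rightarrow> ((complex \<Rightarrow> complex) \<Rightarrow> (complex \<Rightarrow> complex)) \<Rightarrow> bool" where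
  "bounded_op s T \<longleftrightarrow> (\<forall>f\<in>A2 s. T f \<in> A2 s) \<and>
     (\<exists>C. \<forall>f\<in>A2 s. bergman_norm2 s (T f) \<le> C * bergman_norm2 s f)"

definition essentially_normal :: "real \<Rightarrow> ((complex \<Rightarrow> complex) \<Rightarrow> (complex \<Rightarrow> complex)) \<Rightarrow> bool" where
  "essentially_normal s T \<longleftrightarrow> bounded_op s T \<and>
     (\<exists>S. is_adjoint s T S \<and> compact_op s (\<lambda>f. S (T f) - T (S f)))"

definition disk_automorphism :: "(complex \<Rightarrow> complex) \<Rightarrow> bool" where
  "disk_automorphism \<phi> \<longleftrightarrow> \<phi> holomorphic_on ball 0 1 \<and> bij_betw \<phi> (ball 0 1) (ball 0 1)"

end

theory Submission
  imports Defs
begin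

text \<open>
  Let \<open>a = \<phi> 0\<close> and \<open>\<phi> b = 0\<close>, so \<open>|a| = |b| > 0\<close>, and write \<open>T\<close> for composition with \<open>\<phi>\<close>. Reproducing
  kernels are avoided. By change of variables, composition with \<open>\<phi>\<close> or \<open>\<phi>\<^sup>-\<^sup>1\<close> replaces \<open>|f|\<^sup>2\<close> under the
  norm integral by \<open>|f|\<^sup>2\<close> times the \<open>(s+2)\<close>-nd power of \<open>(1-|p|\<^sup>2)/|1 - cnj p z|\<^sup>2\<close>, with \<open>p = a\<close> or
  \<open>p = b\<close> respectively. Choose \<open>\<zeta>\<close> on the unit circle at an angle of at least \<open>\<pi>/2\<close> from both \<open>a\<close> and
  \<open>b\<close>; both factors are then less than 1 at \<open>\<zeta>\<close>. The normalised powers \<open>g\<^sub>n\<close> of the peak function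
  \<open>(1 + cnj \<zeta> z)/2\<close> concentrate at \<open>\<zeta>\<close>, so for some \<open>\<kappa> < 1\<close> eventually \<open>\<parallel>T g\<^sub>n\<parallel>\<^sup>2 < \<kappa>\<close> and
  \<open>\<parallel>g\<^sub>n \<circ> \<phi>\<^sup>-\<^sup>1\<parallel>\<^sup>2 < \<kappa>\<close>. The latter gives \<open>\<parallel>T\<^sup>* g\<^sub>n\<parallel>\<^sup>2 \<ge> 1\<close>, as \<open>1 = \<langle>T (g\<^sub>n \<circ> \<phi>\<^sup>-\<^sup>1), g\<^sub>n\<rangle>\<close>. Hence
  \<open>\<langle>(T\<^sup>*T - TT\<^sup>*) g\<^sub>n, g\<^sub>n\<rangle>\<close> stays below \<open>\<kappa> - 1\<close>, whereas compactness of the commutator and weak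
  convergence of \<open>g\<^sub>n\<close> to 0 would make it tend to 0 along a subsequence.
\<close>

subsection \<open>Square-integrable functions\<close>

lemma measurable_cnj [measurable]: "cnj \<in> borel_measurable borel"
  by (intro borel_measurable_continuous_onI continuous_intros)

lemma integrable_mult_cnj:
  fixes f g :: "'a \<Rightarrow> complex"
  assumes [measurable]: "f \<in> borel_measurable M" "g \<in> borel_measurable M"
    and "integrable M (\<lambda>x. (cmod (f x))\<^sup>2)" "integrable M (\<lambda>x. (cmod (g x))\<^sup>2)"
  shows "integrable M (\<lambda>x. f x * cnj (g x))"
proof (rule Bochner_Integration.integrable_bound)
  show "integrable M (\<lambda>x. (cmod (f x))\<^sup>2 + (cmod (g x))\<^sup>2)"
    using assms by simp
  have "a * b \<le> a\<^sup>2 + b\<^sup>2" if "a \<ge> 0" "b \<ge> 0" for a b :: real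
    using sum_squares_bound[of a b] that mult_nonneg_nonneg[OF that] by linarith
  then show "AE x in M. norm (f x * cnj (g x)) \<le> norm ((cmod (f x))\<^sup>2 + (cmod (g x))\<^sup>2)"
    by (simp add: norm_mult)
qed measurable

text \<open>Cauchy-Schwarz, reduced to the moduli of \<open>f\<close> and \<open>g\<close> so that
  the inequality for \<open>nn_integral\<close> applies; integrability of the squares turns it back
  into a statement about real integrals.\<close>

lemma integral_mult_cnj_le:
  fixes f g :: "'a \<Rightarrow> complex"
  assumes [measurable]: "f \<in> borel_measurable M" "g \<in> borel_measurable M"
    and f2: "integrable M (\<lambda>x. (cmod (f x))\<^sup>2)" and g2: "integrable M (\<lambda>x. (cmod (g x))\<^sup>2)"
  shows "(cmod (\<integral>x. f x * cnj (g x) \<partial>M))\<^sup>2 \<le> (\<integral>x. (cmod (f x))\<^sup>2 \<partial>M) * (\<integral>x. (cmod (g x))\<^sup>2 \<partial>M)"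
proof -
  let ?I = "\<integral>x. cmod (f x) * cmod (g x) \<partial>M"
  have int: "integrable M (\<lambda>x. cmod (f x) * cmod (g x))"
    using integrable_norm[OF integrable_mult_cnj[OF assms]] by (simp add: norm_mult)
  have "(ennreal ?I)\<^sup>2 = (\<integral>\<^sup>+x. ennreal (cmod (f x)) * ennreal (cmod (g x)) \<partial>M)\<^sup>2"
    using nn_integral_eq_integral[OF int] by (simp add: ennreal_mult)
  also have "\<dots> \<le> (\<integral>\<^sup>+x. (ennreal (cmod (f x)))\<^sup>2 \<partial>M) * (\<integral>\<^sup>+x. (ennreal (cmod (g x)))\<^sup>2 \<partial>M)"
    by (rule Cauchy_Schwarz_nn_integral) auto
  also have "\<dots> = ennreal ((\<integral>x. (cmod (f x))\<^sup>2 \<partial>M) * (\<integral>x. (cmod (g x))\<^sup>2 \<partial>M))"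
    using nn_integral_eq_integral[OF f2] nn_integral_eq_integral[OF g2]
    by (simp add: ennreal_mult ennreal_power)
  finally have "?I\<^sup>2 \<le> (\<integral>x. (cmod (f x))\<^sup>2 \<partial>M) * (\<integral>x. (cmod (g x))\<^sup>2 \<partial>M)"
    by (simp add: ennreal_power)
  moreover have "cmod (\<integral>x. f x * cnj (g x) \<partial>M) \<le> ?I"
    using integral_norm_bound[of M "\<lambda>x. f x * cnj (g x)"] by (simp add: norm_mult)
  ultimately show ?thesis
    by (meson norm_ge_zero order_trans power_mono)
qed

subsection \<open>Holomorphic change of variables\<close>

lemma measurable_Complex [measurable]:
  "(\<lambda>x::real^2. Complex (x $ 1) (x $ 2)) \<in> borel_measurable borel"
  by (intro borel_measurable_continuous_onI) (simp add: Complex_eq continuous_intros)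

text \<open>Lebesgue measure is determined by its values on boxes, and a box in the plane pulls back
  to the box in \<open>real^2\<close> with the same sides. This carries the change of variables from
  \<open>real^2\<close> over to the complex plane.\<close>

lemma lborel_complex_eq_distr:
  "(lborel :: complex measure) = distr lborel borel (\<lambda>x::real^2. Complex (x $ 1) (x $ 2))"
proof (rule lborel_eqI)
  fix l u :: complex
  assume le: "\<And>b. b \<in> Basis \<Longrightarrow> l \<bullet> b \<le> u \<bullet> b"
  have "l \<bullet> 1 \<le> u \<bullet> 1" "l \<bullet> \<i> \<le> u \<bullet> \<i>"
    by (intro le; simp add: Basis_complex_def)+
  then have le': "Re l \<le> Re u" "Im l \<le> Im u"
    by simp_all
  let ?L = "vector [Re l, Im l] :: real^2" and ?U = "vector [Re u, Im u] :: real^2"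
  have pre: "(\<lambda>x::real^2. Complex (x $ 1) (x $ 2)) -` box l u \<inter> space lborel = box ?L ?U"
    by (auto simp: in_box_complex_iff mem_box_cart forall_2)
  have "emeasure (distr lborel borel (\<lambda>x::real^2. Complex (x $ 1) (x $ 2))) (box l u)
      = emeasure lborel (box ?L ?U)"
    by (subst emeasure_distr) (simp_all only: pre, simp_all)
  also have "\<dots> = ennreal (\<Prod>b\<in>Basis. (?U - ?L) \<bullet> b)"
  proof (rule emeasure_lborel_box)
    have "\<forall>i. ?L $ i \<le> ?U $ i"
      using le' by (simp add: forall_2)
    then show "?L \<bullet> b \<le> ?U \<bullet> b" if "b \<in> Basis" for b
      using that by (auto simp: Basis_vec_def inner_axis)
  qed
  also have "(\<Prod>b\<in>Basis. (?U - ?L) \<bullet> b) = (Re u - Re l) * (Im u - Im l)"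
  proof -
    have B: "(Basis :: (real^2) set) = range (\<lambda>i. axis i 1)"
      by (auto simp: Basis_vec_def)
    have inj: "inj (\<lambda>i. axis i (1::real) :: real^2)"
      by (auto simp: inj_on_def axis_eq_axis)
    show ?thesis
      unfolding B prod.reindex[OF inj] by (simp add: inner_axis UNIV_2)
  qed
  also have "\<dots> = (\<Prod>b\<in>Basis. (u - l) \<bullet> b)"
    by (simp add: Basis_complex_def)
  finally show "emeasure (distr lborel borel (\<lambda>x::real^2. Complex (x $ 1) (x $ 2))) (box l u)
      = (\<Prod>b\<in>Basis. (u - l) \<bullet> b)" .
qed simp

text \<open>In real coordinates the derivative of \<open>g\<close> is multiplication by
  \<open>g' z\<close>, whose Jacobian determinant is the squared modulus of \<open>g' z\<close>. The
  measurability premises carry indicators, so nothing is demanded of \<open>f\<close> and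
  \<open>g\<close> away from the sets of integration.\<close>

lemma has_integral_change_of_variables_holomorphic:
  fixes g g' :: "complex \<Rightarrow> complex" and f :: "complex \<Rightarrow> real"
  assumes S [measurable]: "S \<in> sets borel"
    and der: "\<And>z. z \<in> S \<Longrightarrow> (g has_field_derivative g' z) (at z within S)"
    and inj: "inj_on g S"
    and mf: "(\<lambda>z. indicator (g ` S) z * f z) \<in> borel_measurable borel"
    and mg: "(\<lambda>z. indicator S z * ((cmod (g' z))\<^sup>2 * f (g z))) \<in> borel_measurable borel"
    and int: "set_integrable lborel S (\<lambda>z. (cmod (g' z))\<^sup>2 * f (g z))"
  shows "set_integrable lborel (g ` S) f"
    and "(LINT z:g ` S|lborel. f z) = (LINT z:S|lborel. (cmod (g' z))\<^sup>2 * f (g z))"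
proof -
  define T where "T = (\<lambda>x::real^2. Complex (x $ 1) (x $ 2))"
  define V where "V = (\<lambda>z. vector [Re z, Im z] :: real^2)"
  have TV [simp]: "T (V z) = z" for z
    by (simp add: T_def V_def complex_eq_iff)
  have VT [simp]: "V (T x) = x" for x
    by (simp add: T_def V_def vec_eq_iff forall_2)
  have T_meas [measurable]: "T \<in> borel_measurable borel"
    unfolding T_def by measurable
  have blT: "bounded_linear T"
    unfolding T_def by (intro linear_conv_bounded_linear[THEN iffD1] linearI) (auto simp: complex_eq_iff)
  have blV: "bounded_linear V"
    unfolding V_def by (intro linear_conv_bounded_linear[THEN iffD1] linearI) (auto simp: vec_eq_iff forall_2)
  define G where "G = V \<circ> g \<circ> T"
  define G' where "G' = (\<lambda>x. V \<circ> (*) (g' (T x)) \<circ> T)"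
  have TVS: "T ` (T -` S) = S" for S
    by (metis TV surj_def surj_image_vimage_eq)
  have lin: "(G has_derivative G' x) (at x within T -` S)" if "x \<in> T -` S" for x
  proof -
    have "(g has_derivative (*) (g' (T x))) (at (T x) within T ` (T -` S))"
      unfolding TVS using der[of "T x"] that by (simp add: has_field_derivative_def)
    then have "(g \<circ> T has_derivative (*) (g' (T x)) \<circ> T) (at x within T -` S)"
      by (rule diff_chain_within[OF bounded_linear_imp_has_derivative[OF blT]])
    then show ?thesis
      unfolding G_def G'_def comp_assoc
      by (rule diff_chain_within[OF _ bounded_linear_imp_has_derivative[OF blV]])
  qed
  \<comment> \<open>Multiplication by \<open>u + \<i> * v\<close> has rows \<open>(u, -v)\<close>
    and \<open>(v, u)\<close>, hence determinant \<open>u\<^sup>2 + v\<^sup>2\<close>.\<close>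
  have det: "\<bar>det (matrix (G' x))\<bar> = (cmod (g' (T x)))\<^sup>2" for x
    by (simp add: det_2 matrix_def G'_def V_def T_def axis_def cmod_def power2_eq_square)
  have injG: "inj_on G (T -` S)"
    using inj unfolding G_def inj_on_def by (metis TV VT comp_apply vimage_eq)
  have imG: "G ` (T -` S) = T -` (g ` S)"
    unfolding G_def image_comp[symmetric] TVS by (auto simp: image_iff) (metis VT)
  let ?w = "\<lambda>z. (cmod (g' z))\<^sup>2 * f (g z)"
  \<comment> \<open>Transfer between set integrals over the complex plane and over
    \<open>real^2\<close>. The target is the completed measure \<open>lebesgue\<close>, in which
    \<open>absolutely_integrable_on\<close> is phrased.\<close>
  have tr: "(set_integrable lborel A h \<longleftrightarrow> set_integrable lebesgue (T -` A) (\<lambda>x. h (T x))) \<and>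
      (LINT z:A|lborel. h z) = (LINT x:T -` A|lebesgue. h (T x))"
    if [measurable]: "(\<lambda>z. indicator A z * h z) \<in> borel_measurable borel" for A and h :: "complex \<Rightarrow> real"
  proof -
    have m [measurable]: "(\<lambda>x. indicator A (T x) * h (T x)) \<in> borel_measurable borel"
      using measurable_compose[OF T_meas that] .
    have ind: "indicator (T -` A) x = (indicator A (T x) :: real)" for x
      by (simp add: indicator_def)
    have D: "lborel = distr lborel borel T"
      unfolding T_def by (rule lborel_complex_eq_distr)
    have "integrable lborel (\<lambda>z. indicator A z * h z) \<longleftrightarrow>
        integrable lborel (\<lambda>x. indicator A (T x) * h (T x))"
      by (subst D, subst integrable_distr_eq) simp_all
    moreover have "(LINT z|lborel. indicator A z * h z) = (LINT x|lborel. indicator A (T x) * h (T x))"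
      by (subst D, subst integral_distr) simp_all
    ultimately show ?thesis
      unfolding set_integrable_def set_lebesgue_integral_def
      by (simp add: ind integrable_completion integral_completion)
  qed
  have Sl: "T -` S \<in> sets lebesgue"
  proof -
    have "T -` S \<in> sets borel"
      using measurable_sets_borel[OF T_meas S] by simp
    then show ?thesis
      by simp
  qed
  have TG: "T (G x) = g (T x)" for x
    by (simp add: G_def)
  have ints: "set_integrable lebesgue (T -` S) (\<lambda>x. ?w (T x))"
    using int tr[OF mg] by simp
  \<comment> \<open>The change of variables is an equivalence for vector-valued integrands with a
    prescribed integral. The real \<open>f\<close> is read as a map into \<open>real^1\<close>, and
    the prescribed value is the pulled-back integral itself, so the left side holds by
    \<open>ints\<close>.\<close>
  have "(\<lambda>x. \<bar>det (matrix (G' x))\<bar> *\<^sub>R (vec (f (T (G x))) :: real^1)) absolutely_integrable_on T -` S \<and>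
      integral (T -` S) (\<lambda>x. \<bar>det (matrix (G' x))\<bar> *\<^sub>R (vec (f (T (G x))) :: real^1))
        = vec (integral (T -` S) (\<lambda>x. ?w (T x))) \<longleftrightarrow>
      (\<lambda>x. vec (f (T x)) :: real^1) absolutely_integrable_on G ` (T -` S) \<and>
      integral (G ` (T -` S)) (\<lambda>x. vec (f (T x)) :: real^1) = vec (integral (T -` S) (\<lambda>x. ?w (T x)))"
    by (rule has_absolute_integral_change_of_variables[OF Sl lin injG])
  then have cov: "(\<lambda>x. f (T x)) absolutely_integrable_on (T -` (g ` S))"
    "integral (T -` (g ` S)) (\<lambda>x. f (T x)) = integral (T -` S) (\<lambda>x. ?w (T x))"
    using ints by (simp_all add: absolutely_integrable_on_1_iff integral_on_1_eq det imG TG)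
  show "set_integrable lborel (g ` S) f"
    using cov tr[OF mf] by simp
  show "(LINT z:g ` S|lborel. f z) = (LINT z:S|lborel. (cmod (g' z))\<^sup>2 * f (g z))"
    using tr[OF mf] tr[OF mg] set_lebesgue_integral_eq_integral(2)[OF cov(1)]
      set_lebesgue_integral_eq_integral(2)[OF ints] cov(2) by simp
qed

subsection \<open>The weighted Bergman space\<close>

lemma integrable_one_minus_norm_powr:
  assumes s: "s > -1"
  shows "set_integrable lborel (ball 0 1) (\<lambda>z::complex. (1 - (cmod z)\<^sup>2) powr s)"
proof -
  \<comment> \<open>Dyadic annuli: the weight is comparable to \<open>2\<^sup>-\<^sup>k\<^sup>s\<close> on \<open>A k\<close>, whose area is at most \<open>\<pi> 2\<^sup>-\<^sup>k\<close>.\<close>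
  define A where "A k = {z::complex. (1/2) ^ Suc k < 1 - (cmod z)\<^sup>2 \<and> 1 - (cmod z)\<^sup>2 \<le> (1/2) ^ k}" for k :: nat
  \<comment> \<open>On \<open>1/2 < t \<le> 1\<close> the power \<open>t powr s\<close> is at most 1
    for \<open>s \<ge> 0\<close> and at most \<open>2 powr (-s)\<close> for negative
    \<open>s\<close>; \<open>C\<close> dominates both.\<close>
  define C where "C = 2 powr \<bar>s\<bar>"
  define c where "c k = C * ((1/2) ^ k) powr s" for k :: nat
  have [measurable]: "A k \<in> sets borel" for k
    unfolding A_def by measurable
  have c_nonneg: "c k \<ge> 0" for k
    by (simp add: c_def C_def)
  have bound: "(1 - (cmod z)\<^sup>2) powr s \<le> c k" if z: "z \<in> A k" for z k
  proof -
    define t where "t = (1 - (cmod z)\<^sup>2) / (1/2) ^ k"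
    have t: "1/2 < t" "t \<le> 1"
      using z by (auto simp: A_def t_def field_simps)
    have "t powr s \<le> C"
    proof (cases "s \<ge> 0")
      case True
      then show ?thesis
        using t powr_mono2[of s t 1] ge_one_powr_ge_zero[of 2 "\<bar>s\<bar>"] by (simp add: C_def)
    next
      case False
      then have "t powr s \<le> (1/2) powr s"
        using t by (intro powr_mono2') auto
      then show ?thesis
        using False by (simp add: C_def powr_divide powr_minus_divide)
    qed
    moreover have "1 - (cmod z)\<^sup>2 = t * (1/2) ^ k"
      by (simp add: t_def)
    ultimately show ?thesis
      using t by (simp add: c_def powr_mult mult_right_mono)
  qed
  have cover: "\<exists>k. z \<in> A k" if z: "z \<in> ball 0 1" for z
  proof -
    define t where "t = 1 - (cmod z)\<^sup>2"
    have t: "0 < t" "t \<le> 1"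
      using z by (auto simp: t_def power_less_one_iff abs_square_less_1)
    obtain n where n: "(1/2) ^ n < t"
      using t real_arch_pow_inv[of t "1/2"] by auto
    \<comment> \<open>The least exponent \<open>m\<close> with \<open>(1/2)^m < t\<close> is nonzero
      because \<open>t \<le> 1\<close>; its predecessor \<open>k\<close> fails the inequality, which
      is the upper bound in \<open>A k\<close>.\<close>
    define m where "m = (LEAST n. (1/2::real) ^ n < t)"
    have m: "(1/2::real) ^ m < t"
      unfolding m_def by (rule LeastI[of _ n]) (rule n)
    have "m \<noteq> 0"
      using m t by (intro notI) simp
    then obtain k where k: "m = Suc k"
      using not0_implies_Suc by blast
    have "\<not> (1/2::real) ^ k < t"
      using k not_less_Least[of k "\<lambda>n. (1/2::real) ^ n < t"] unfolding m_def by simp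
    then show ?thesis
      using m k by (intro exI[of _ k]) (auto simp: A_def t_def)
  qed
  \<comment> \<open>\<open>A k\<close> lies between the circles with squared radii
    \<open>1 - (1/2)^k\<close> and \<open>1 - (1/2)^(k+1)\<close>. The area in between is
    \<open>pi * (1/2)^(k+1)\<close>, bounded generously here.\<close>
  have meas: "emeasure lborel (A k) \<le> ennreal (pi * (1/2) ^ k)" for k
  proof -
    let ?r = "sqrt (1 - (1/2) ^ Suc k)" and ?q = "sqrt (1 - (1/2) ^ k)"
    have le: "(1/2::real) ^ k \<le> 1" "(1/2::real) ^ Suc k \<le> 1"
      by (rule power_le_one; simp)+
    have "A k \<subseteq> ball 0 ?r - ball 0 ?q"
    proof
      fix z assume "z \<in> A k"
      then have "(cmod z)\<^sup>2 < 1 - (1/2) ^ Suc k" "(cmod z)\<^sup>2 \<ge> 1 - (1/2) ^ k"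
        by (auto simp: A_def)
      then have "cmod z < ?r" "?q \<le> cmod z"
        using real_less_rsqrt real_le_lsqrt by (blast, simp add: real_sqrt_le_iff real_le_lsqrt)
      then show "z \<in> ball 0 ?r - ball 0 ?q"
        by simp
    qed
    then have "emeasure lborel (A k) \<le> emeasure lborel (ball (0::complex) ?r - ball 0 ?q)"
      by (intro emeasure_mono) auto
    also have "\<dots> = emeasure lborel (ball (0::complex) ?r) - emeasure lborel (ball (0::complex) ?q)"
    proof (rule emeasure_Diff)
      show "ball (0::complex) ?q \<subseteq> ball 0 ?r"
        by (rule subset_ball) simp
      show "emeasure lborel (ball (0::complex) ?q) \<noteq> \<infinity>"
        using emeasure_lborel_ball_finite[of "0::complex" ?q] by simp
    qed auto
    also have "\<dots> = ennreal (pi * (1 - (1/2) ^ Suc k)) - ennreal (pi * (1 - (1/2) ^ k))"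
      using le by (simp add: emeasure_ball unit_ball_vol_2)
    also have "\<dots> = ennreal (pi * (1 - (1/2) ^ Suc k) - pi * (1 - (1/2) ^ k))"
    proof (rule ennreal_minus)
      have "0 \<le> 1 - (1/2::real) ^ k"
        using le by linarith
      then show "0 \<le> pi * (1 - (1/2) ^ k)"
        by (rule mult_nonneg_nonneg[OF pi_ge_zero])
    qed
    also have "\<dots> \<le> ennreal (pi * (1/2) ^ k)"
    proof (rule ennreal_leI)
      have "0 \<le> pi * (1/2) ^ k"
        by simp
      then show "pi * (1 - (1/2) ^ Suc k) - pi * (1 - (1/2) ^ k) \<le> pi * (1/2) ^ k"
        unfolding power_Suc right_diff_distrib by linarith
    qed
    finally show ?thesis .
  qed
  \<comment> \<open>The bounds form a geometric series with ratio \<open>(1/2) powr (1 + s)\<close>;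
    the assumption \<open>s > -1\<close> makes this ratio less than 1.\<close>
  have eq: "c k * (pi * (1/2) ^ k) = C * pi * ((1/2) powr (1 + s)) ^ k" for k
  proof -
    have "((1/2) ^ k) powr s * (1/2::real) ^ k = ((1/2) powr (1 + s)) ^ k"
      by (simp add: powr_realpow[symmetric] powr_powr powr_add[symmetric] algebra_simps)
    then show ?thesis
      by (simp add: c_def mult_ac)
  qed
  have "(1/2::real) powr (1 + s) < 1"
    using s gr_one_powr[of 2 "1 + s"] by (simp add: powr_divide)
  then have sum: "summable (\<lambda>k. c k * (pi * (1/2) ^ k))"
    unfolding eq by (intro summable_mult summable_geometric) simp
  have "(\<integral>\<^sup>+z. ennreal (indicator (ball 0 1) z * (1 - (cmod z)\<^sup>2) powr s) \<partial>lborel)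
      \<le> (\<integral>\<^sup>+z. (\<Sum>k. ennreal (c k) * indicator (A k) z) \<partial>lborel)"
  proof (rule nn_integral_mono)
    fix z :: complex
    show "ennreal (indicator (ball 0 1) z * (1 - (cmod z)\<^sup>2) powr s) \<le> (\<Sum>k. ennreal (c k) * indicator (A k) z)"
    proof (cases "z \<in> ball 0 1")
      case True
      then obtain k where k: "z \<in> A k"
        using cover by blast
      have "ennreal (indicator (ball 0 1) z * (1 - (cmod z)\<^sup>2) powr s) \<le> ennreal (c k) * indicator (A k) z"
        using bound[OF k] True k by (simp add: ennreal_leI)
      also have "\<dots> = (\<Sum>j\<in>{k}. ennreal (c j) * indicator (A j) z)"
        by (simp only: sum.insert sum.empty finite.emptyI empty_iff not_False_eq_True add_0_right)
      also have "\<dots> \<le> (\<Sum>j. ennreal (c j) * indicator (A j) z)"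
        by (intro sum_le_suminf) auto
      finally show ?thesis .
    qed simp
  qed
  also have "\<dots> = (\<Sum>k. ennreal (c k) * emeasure lborel (A k))"
    by (subst nn_integral_suminf) (simp_all add: nn_integral_cmult_indicator)
  also have "\<dots> \<le> (\<Sum>k. ennreal (c k * (pi * (1/2) ^ k)))"
    using meas by (intro suminf_le) (auto simp: ennreal_mult c_nonneg intro!: mult_left_mono)
  also have "\<dots> < \<infinity>"
    using sum c_nonneg by (simp add: suminf_ennreal2 less_top[symmetric])
  finally show ?thesis
    unfolding set_integrable_def
    by (intro integrableI_bounded borel_measurable_scaleR borel_measurable_indicator) (auto simp: abs_mult)
qed

section \<open>The weighted area measure of the disk\<close>

definition bergman_measure :: "real \<Rightarrow> complex measure" where
  "bergman_measure s = density lborel (\<lambda>z. ennreal (indicator (ball 0 1) z * bergman_weight s z))"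

lemma sets_bergman_measure [simp, measurable_cong]: "sets (bergman_measure s) = sets borel"
  and space_bergman_measure [simp]: "space (bergman_measure s) = UNIV"
  by (simp_all add: bergman_measure_def)

lemma borel_measurable_bergman_weight [measurable]: "bergman_weight s \<in> borel_measurable borel"
  unfolding bergman_weight_def by measurable

lemma borel_measurable_bergman_density [measurable, simp]:
  "(\<lambda>z. indicator (ball 0 1) z * bergman_weight s z) \<in> borel_measurable borel"
  by (intro borel_measurable_times borel_measurable_indicator borel_measurable_bergman_weight) simp

lemma bergman_weight_nonneg: "s > -1 \<Longrightarrow> 0 \<le> bergman_weight s z"
  by (simp add: bergman_weight_def)

lemma bergman_weight_pos: "s > -1 \<Longrightarrow> z \<in> ball 0 1 \<Longrightarrow> 0 < bergman_weight s z"
  by (auto simp: bergman_weight_def abs_square_eq_1 power2_eq_1_iff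
      intro!: mult_pos_pos divide_pos_pos)

lemma integrable_bergman_measure_iff:
  fixes f :: "complex \<Rightarrow> 'a::{banach, second_countable_topology}"
  assumes "s > -1" "f \<in> borel_measurable borel"
  shows "integrable (bergman_measure s) f \<longleftrightarrow>
    set_integrable lborel (ball 0 1) (\<lambda>z. bergman_weight s z *\<^sub>R f z)"
  unfolding bergman_measure_def set_integrable_def using assms
  by (subst integrable_density) (auto simp: bergman_weight_nonneg)

lemma integral_bergman_measure:
  fixes f :: "complex \<Rightarrow> 'a::{banach, second_countable_topology}"
  assumes "s > -1" "f \<in> borel_measurable borel"
  shows "integral\<^sup>L (bergman_measure s) f = (LINT z:ball 0 1|lborel. bergman_weight s z *\<^sub>R f z)"
  unfolding bergman_measure_def set_lebesgue_integral_def using assms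
  by (subst integral_density) (auto simp: bergman_weight_nonneg)

lemma finite_measure_bergman:
  assumes "s > -1"
  shows "finite_measure (bergman_measure s)"
proof -
  have "set_integrable lborel (ball 0 1) (bergman_weight s)"
    unfolding bergman_weight_def using integrable_one_minus_norm_powr[OF assms] by simp
  then have "integrable (bergman_measure s) (\<lambda>_. 1 :: real)"
    using assms by (simp add: integrable_bergman_measure_iff)
  then have "emeasure (bergman_measure s) (space (bergman_measure s)) < \<infinity>"
    by (simp add: integrable_iff_bounded)
  then show ?thesis
    by (intro finite_measureI) simp
qed

text \<open>The density is strictly positive on the disk and a nonempty open set is not a Lebesgue
  null set. This makes the lower bound for the norms of the peak powers nontrivial.\<close>

lemma measure_bergman_pos:
  assumes s: "s > -1" and "open U" "U \<noteq> {}" "U \<subseteq> ball 0 1"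
  shows "0 < measure (bergman_measure s) U"
proof -
  interpret finite_measure "bergman_measure s"
    by (rule finite_measure_bergman[OF s])
  have [measurable]: "U \<in> sets borel"
    using \<open>open U\<close> by simp
  have "emeasure (bergman_measure s) U \<noteq> 0"
  proof
    assume "emeasure (bergman_measure s) U = 0"
    then have "AE z in lborel. z \<notin> U"
    proof -
      have "U \<in> null_sets (bergman_measure s)"
        using \<open>emeasure (bergman_measure s) U = 0\<close> by (intro null_setsI) auto
      then have "AE z in lborel. z \<in> U \<longrightarrow> ennreal (indicator (ball 0 1) z * bergman_weight s z) = 0"
        unfolding bergman_measure_def by (subst (asm) null_sets_density_iff) simp_all
      then show ?thesis
      proof eventually_elim
        case (elim z)
        then show ?case
          using bergman_weight_pos[OF s, of z] assms(4) by (auto simp: ennreal_eq_0_iff)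
      qed
    qed
    then have "U \<in> null_sets lborel"
      by (subst (asm) AE_iff_null_sets[symmetric]) auto
    then show False
      using assms(2,3) open_not_negligible negligible_iff_null_sets null_sets_completionI by blast
  qed
  then show ?thesis
    by (simp add: measure_def enn2real_positive_iff emeasure_finite less_top[symmetric] zero_less_iff_neq_zero)
qed

section \<open>Membership, norm and inner product in \<open>A2\<close>\<close>

lemma borel_measurable_holomorphic_vanishing:
  assumes "f holomorphic_on ball 0 1" "\<And>z. z \<notin> ball 0 1 \<Longrightarrow> f z = 0"
  shows "f \<in> borel_measurable borel"
proof -
  have "(\<lambda>z. indicator (ball 0 1) z *\<^sub>R f z) \<in> borel_measurable borel"
    using assms(1) by (intro borel_measurable_continuous_on_indicator holomorphic_on_imp_continuous_on) auto
  also have "(\<lambda>z. indicator (ball 0 1) z *\<^sub>R f z) = f"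
    using assms(2) by (auto simp: indicator_def fun_eq_iff)
  finally show ?thesis .
qed

lemma A2_measurable: "f \<in> A2 s \<Longrightarrow> f \<in> borel_measurable borel"
  by (rule borel_measurable_holomorphic_vanishing) (auto simp: A2_def)

text \<open>The integrability premise may assume Borel measurability, because holomorphy on the disk
  and vanishing outside already imply it.\<close>

lemma A2_I:
  assumes s: "s > -1" and hol: "f holomorphic_on ball 0 1" and zero: "\<And>z. z \<notin> ball 0 1 \<Longrightarrow> f z = 0"
    and int: "f \<in> borel_measurable borel \<Longrightarrow> integrable (bergman_measure s) (\<lambda>z. (cmod (f z))\<^sup>2)"
  shows "f \<in> A2 s"
proof -
  have [measurable]: "f \<in> borel_measurable borel"
    by (rule borel_measurable_holomorphic_vanishing[OF hol zero])
  show ?thesis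
    using int hol zero s by (simp add: A2_def integrable_bergman_measure_iff mult.commute)
qed

lemma A2_integrable:
  assumes "s > -1" "f \<in> A2 s"
  shows "integrable (bergman_measure s) (\<lambda>z. (cmod (f z))\<^sup>2)"
  using assms A2_measurable[of f s]
  by (simp add: A2_def integrable_bergman_measure_iff mult.commute)

lemma bergman_norm2_eq:
  assumes "s > -1" "f \<in> A2 s"
  shows "bergman_norm2 s f = (\<integral>z. (cmod (f z))\<^sup>2 \<partial>bergman_measure s)"
  using assms A2_measurable[of f s]
  by (simp add: bergman_norm2_def integral_bergman_measure mult.commute)

lemma bergman_inner_eq:
  assumes "s > -1" "f \<in> A2 s" "g \<in> A2 s"
  shows "bergman_inner s f g = (\<integral>z. f z * cnj (g z) \<partial>bergman_measure s)"
  using assms A2_measurable[of f s] A2_measurable[of g s]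
  by (simp add: bergman_inner_def integral_bergman_measure scaleR_conv_of_real mult_ac)

lemma bergman_inner_integrable:
  assumes "s > -1" "f \<in> A2 s" "g \<in> A2 s"
  shows "integrable (bergman_measure s) (\<lambda>z. f z * cnj (g z))"
  using assms A2_measurable[of f s] A2_measurable[of g s]
  by (intro integrable_mult_cnj A2_integrable) (auto simp: measurable_def)

lemma A2_bounded:
  assumes s: "s > -1" and "f holomorphic_on ball 0 1" "\<And>z. z \<notin> ball 0 1 \<Longrightarrow> f z = 0"
    and "\<And>z. z \<in> ball 0 1 \<Longrightarrow> cmod (f z) \<le> B"
  shows "f \<in> A2 s"
proof (rule A2_I[OF assms(1-3)])
  interpret finite_measure "bergman_measure s"
    by (rule finite_measure_bergman[OF s])
  have "cmod (f z) \<le> \<bar>B\<bar>" for z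
    using assms(3)[of z] assms(4)[of z] by (cases "z \<in> ball 0 1") auto
  then have B: "(cmod (f z))\<^sup>2 \<le> B\<^sup>2" for z
    by (simp add: abs_le_square_iff[symmetric])
  assume [measurable]: "f \<in> borel_measurable borel"
  show "integrable (bergman_measure s) (\<lambda>z. (cmod (f z))\<^sup>2)"
    using B by (intro integrable_const_bound[where B = "B\<^sup>2"]) auto
qed

lemma A2_diff:
  assumes s: "s > -1" and f: "f \<in> A2 s" and g: "g \<in> A2 s"
  shows "f - g \<in> A2 s"
proof (rule A2_I[OF s])
  show "(f - g) holomorphic_on ball 0 1"
    using f g by (auto simp: A2_def fun_diff_def intro: holomorphic_intros)
  show "(f - g) z = 0" if "z \<notin> ball 0 1" for z
    using f g that by (auto simp: A2_def)
  assume [measurable]: "f - g \<in> borel_measurable borel"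
  show "integrable (bergman_measure s) (\<lambda>z. (cmod ((f - g) z))\<^sup>2)"
  proof (rule Bochner_Integration.integrable_bound)
    show "integrable (bergman_measure s) (\<lambda>z. 2 * (cmod (f z))\<^sup>2 + 2 * (cmod (g z))\<^sup>2)"
      using A2_integrable[OF s] f g by simp
    have "(cmod (x - y))\<^sup>2 \<le> 2 * (cmod x)\<^sup>2 + 2 * (cmod y)\<^sup>2" for x y
      using power_mono[OF norm_triangle_ineq4[of x y], of 2] sum_squares_bound[of "cmod x" "cmod y"]
      by (simp add: power2_sum)
    then show "AE z in bergman_measure s. norm ((cmod ((f - g) z))\<^sup>2)
        \<le> norm (2 * (cmod (f z))\<^sup>2 + 2 * (cmod (g z))\<^sup>2)"
      by simp
  qed measurable
qed

lemma bergman_inner_le: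
  assumes "s > -1" "f \<in> A2 s" "g \<in> A2 s"
  shows "(cmod (bergman_inner s f g))\<^sup>2 \<le> bergman_norm2 s f * bergman_norm2 s g"
  using assms A2_measurable[of f s] A2_measurable[of g s]
  by (simp add: bergman_inner_eq bergman_norm2_eq)
    (intro integral_mult_cnj_le A2_integrable; auto simp: measurable_def)

lemma bergman_inner_diff_left:
  assumes "s > -1" "f \<in> A2 s" "g \<in> A2 s" "h \<in> A2 s"
  shows "bergman_inner s (f - g) h = bergman_inner s f h - bergman_inner s g h"
  using assms
  by (simp add: bergman_inner_eq A2_diff ring_distribs bergman_inner_integrable)

lemma bergman_inner_self:
  assumes "s > -1" "f \<in> A2 s"
  shows "bergman_inner s f f = of_real (bergman_norm2 s f)"
  using assms by (simp add: bergman_inner_eq bergman_norm2_eq complex_norm_square[symmetric]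
      of_real_power[symmetric] del: of_real_power)

lemma bergman_inner_cnj:
  "cnj (bergman_inner s f g) = bergman_inner s g f"
  unfolding bergman_inner_def set_lebesgue_integral_def
  by (subst Bochner_Integration.integral_cnj[symmetric]) (simp add: mult_ac)

subsection \<open>Disk automorphisms\<close>

definition disk_moebius :: "complex \<Rightarrow> complex \<Rightarrow> complex \<Rightarrow> complex" where
  "disk_moebius c a z = c * (z - a) / (1 - cnj a * z)"

lemma one_minus_cnj_mult_nonzero:
  assumes "cmod a < 1" "cmod z \<le> 1"
  shows "1 - cnj a * z \<noteq> 0"
proof
  assume "1 - cnj a * z = 0"
  then have "cmod a * cmod z = 1"
    by (metis complex_mod_cnj eq_iff_diff_eq_0 norm_mult norm_one)
  moreover have "cmod a * cmod z \<le> cmod a * 1"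
    using assms by (intro mult_left_mono) auto
  ultimately show False
    using assms by simp
qed

text \<open>The second factor is the modulus of the derivative of the map. Hence composing the
  Bergman weight with a disk automorphism multiplies it by the \<open>s\<close>-th power of that
  modulus.\<close>

lemma one_minus_norm_disk_moebius:
  assumes "cmod c = 1" "cmod a < 1" "cmod z < 1"
  shows "1 - (cmod (disk_moebius c a z))\<^sup>2
    = (1 - (cmod z)\<^sup>2) * ((1 - (cmod a)\<^sup>2) / (cmod (1 - cnj a * z))\<^sup>2)"
proof -
  have "(cmod (1 - cnj a * z))\<^sup>2 - (cmod (z - a))\<^sup>2 = (1 - (cmod z)\<^sup>2) * (1 - (cmod a)\<^sup>2)"
    unfolding cmod_power2 by (simp add: power2_eq_square algebra_simps)
  moreover have "(cmod (1 - cnj a * z))\<^sup>2 \<noteq> 0"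
    using one_minus_cnj_mult_nonzero[of a z] assms by simp
  moreover have "cmod (disk_moebius c a z) = cmod (z - a) / cmod (1 - cnj a * z)"
    using assms by (simp add: disk_moebius_def norm_mult norm_divide)
  moreover have "1 - (x / y)\<^sup>2 = (y\<^sup>2 - x\<^sup>2) / y\<^sup>2" if "y\<^sup>2 \<noteq> 0" for x y :: real
    using that by (simp add: power_divide diff_divide_distrib)
  ultimately show ?thesis
    by simp
qed

lemma disk_moebius_in_ball:
  assumes "cmod c = 1" "cmod a < 1" "z \<in> ball 0 1"
  shows "disk_moebius c a z \<in> ball 0 1"
proof -
  have "0 < (1 - (cmod z)\<^sup>2) * ((1 - (cmod a)\<^sup>2) / (cmod (1 - cnj a * z))\<^sup>2)"
    using assms one_minus_cnj_mult_nonzero[of a z]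
    by (intro mult_pos_pos divide_pos_pos) (auto simp: abs_square_less_1)
  then have "(cmod (disk_moebius c a z))\<^sup>2 < 1"
    using one_minus_norm_disk_moebius[of c a z] assms by simp
  then show ?thesis
    by (simp add: abs_square_less_1)
qed

text \<open>The inverse vanishes at the image of 0, which is \<open>- c * a\<close>, and rotates by
  \<open>cnj c\<close>. Numerator and denominator of the composition share the factor
  \<open>(1 - cnj a * a) / (1 - cnj a * z)\<close>, which cancels.\<close>

lemma disk_moebius_inverse:
  assumes c: "cmod c = 1" and "cmod a < 1" "z \<in> ball 0 1"
  shows "disk_moebius (cnj c) (- c * a) (disk_moebius c a z) = z"
proof -
  have cc: "c * cnj c = 1"
    using c by (simp add: complex_norm_square[symmetric])
  have nz: "1 - cnj a * z \<noteq> 0" "1 - cnj a * a \<noteq> 0"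
    using assms one_minus_cnj_mult_nonzero[of a z] one_minus_cnj_mult_nonzero[of a a] by simp_all
  have "disk_moebius c a z + c * a = c * ((1 - cnj a * a) * z / (1 - cnj a * z))"
    using nz by (simp add: disk_moebius_def field_simps)
  moreover have "1 + cnj c * cnj a * disk_moebius c a z = (1 - cnj a * a) / (1 - cnj a * z)"
  proof -
    have "cnj c * cnj a * disk_moebius c a z = (c * cnj c) * (cnj a * (z - a) / (1 - cnj a * z))"
      by (simp add: disk_moebius_def)
    then show ?thesis
      unfolding cc using nz by (simp add: field_simps)
  qed
  ultimately have "disk_moebius (cnj c) (- c * a) (disk_moebius c a z)
    = (c * cnj c) * (((1 - cnj a * a) * z / (1 - cnj a * z)) / ((1 - cnj a * a) / (1 - cnj a * z)))"
    by (simp add: disk_moebius_def[of "cnj c"])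
  then show ?thesis
    unfolding cc using nz by simp
qed

lemma has_field_derivative_disk_moebius:
  assumes "cmod a < 1" "z \<in> ball 0 1"
  shows "(disk_moebius c a has_field_derivative c * (1 - cnj a * a) / (1 - cnj a * z)\<^sup>2) (at z within S)"
proof -
  have "1 - cnj a * z \<noteq> 0"
    using assms by (intro one_minus_cnj_mult_nonzero) auto
  then show ?thesis
    unfolding disk_moebius_def[abs_def]
    by (auto intro!: derivative_eq_intros simp: power2_eq_square) (simp add: field_simps)
qed

lemma disk_moebius_holomorphic:
  assumes "cmod a < 1"
  shows "disk_moebius c a holomorphic_on ball 0 1"
  unfolding holomorphic_on_def field_differentiable_def
  using has_field_derivative_disk_moebius[OF assms] by blast

text \<open>Moving the zero of \<open>\<phi>\<close> to the origin by a Moebius map gives an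
  automorphism \<open>F\<close> fixing 0. The Schwarz lemma for \<open>F\<close> and for its inverse
  \<open>G\<close> forces \<open>F\<close> to preserve moduli, so \<open>F\<close> is a
  rotation.\<close>

lemma disk_automorphism_eq_moebius:
  assumes "disk_automorphism \<phi>"
  obtains c a where "cmod c = 1" "cmod a < 1" "\<And>z. z \<in> ball 0 1 \<Longrightarrow> \<phi> z = disk_moebius c a z"
proof -
  have hol: "\<phi> holomorphic_on ball 0 1" and bij: "bij_betw \<phi> (ball 0 1) (ball 0 1)"
    using assms by (auto simp: disk_automorphism_def)
  define \<psi> where "\<psi> = inv_into (ball 0 1) \<phi>"
  have \<psi>: "\<psi> w \<in> ball 0 1" "\<phi> (\<psi> w) = w" if "w \<in> ball 0 1" for w
    using that bij unfolding \<psi>_def by (metis bij_betw_def inv_into_into f_inv_into_f)+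
  have \<psi>\<phi>: "\<psi> (\<phi> z) = z" if "z \<in> ball 0 1" for z
    using that bij unfolding \<psi>_def by (simp add: bij_betw_def)
  have \<phi>in: "\<phi> z \<in> ball 0 1" if "z \<in> ball 0 1" for z
    using that bij by (auto simp: bij_betw_def)
  have hol\<psi>: "\<psi> holomorphic_on ball 0 1"
  proof -
    obtain g where g: "g holomorphic_on (\<phi> ` ball 0 1)" "\<And>z. z \<in> ball 0 1 \<Longrightarrow> g (\<phi> z) = z"
      using holomorphic_has_inverse[OF hol open_ball] bij by (metis bij_betw_def)
    have "g w = \<psi> w" if "w \<in> ball 0 1" for w
      using g(2)[OF \<psi>(1)[OF that]] \<psi>(2)[OF that] by simp
    then show ?thesis
      using g(1) bij by (metis bij_betw_def holomorphic_cong)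
  qed
  define a where "a = \<psi> 0"
  have a: "cmod a < 1" "\<phi> a = 0"
    using \<psi>[of 0] by (auto simp: a_def)
  \<comment> \<open>\<open>m\<close> sends 0 to \<open>a\<close>, and \<open>n\<close> is its
    inverse.\<close>
  define m where "m = disk_moebius 1 (- a)"
  define n where "n = disk_moebius 1 a"
  have mn: "m (n z) = z" if "z \<in> ball 0 1" for z
    using disk_moebius_inverse[of 1 a z] a that by (simp add: m_def n_def)
  have nm: "n (m z) = z" if "z \<in> ball 0 1" for z
    using disk_moebius_inverse[of 1 "- a" z] a that by (simp add: m_def n_def)
  have min: "m z \<in> ball 0 1" and nin: "n z \<in> ball 0 1" if "z \<in> ball 0 1" for z
    unfolding m_def n_def by (rule disk_moebius_in_ball; use that a in simp)+
  have holm: "m holomorphic_on ball 0 1" and holn: "n holomorphic_on ball 0 1"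
    using a by (auto simp: m_def n_def intro!: disk_moebius_holomorphic)
  define F where "F = (\<lambda>z. \<phi> (m z))"
  define G where "G = (\<lambda>z. n (\<psi> z))"
  have holF: "F holomorphic_on ball 0 1"
    unfolding F_def using holomorphic_on_compose_gen[OF holm hol] min
    by (auto simp: o_def image_subset_iff simp del: mem_ball)
  have holG: "G holomorphic_on ball 0 1"
    unfolding G_def using holomorphic_on_compose_gen[OF hol\<psi> holn] \<psi>(1)
    by (auto simp: o_def image_subset_iff simp del: mem_ball)
  have F0: "F 0 = 0"
    using a by (simp add: F_def m_def disk_moebius_def)
  have G0: "G 0 = 0"
    by (simp add: G_def n_def disk_moebius_def a_def)
  have Fle: "cmod (F z) \<le> cmod z" if "cmod z < 1" for z
    using Schwarz_Lemma(1)[OF holF F0 _ that] \<phi>in min by (auto simp: F_def)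
  have Gle: "cmod (G z) \<le> cmod z" if "cmod z < 1" for z
    using Schwarz_Lemma(1)[OF holG G0 _ that] \<psi> nin by (auto simp: G_def)
  have GF: "G (F z) = z" if "z \<in> ball 0 1" for z
    using that by (simp only: F_def G_def \<psi>\<phi> min nm)
  \<comment> \<open>Equality at a single nonzero point suffices for the rigidity part of the Schwarz
    lemma; \<open>1/2\<close> is an arbitrary choice.\<close>
  have Feq: "cmod (F (1/2)) = cmod (1/2)"
  proof (rule antisym)
    show "cmod (F (1/2)) \<le> cmod (1/2)"
      by (rule Fle) simp
    then have "cmod (F (1/2)) < 1"
      by simp
    then show "cmod (1/2) \<le> cmod (F (1/2))"
      using Gle[of "F (1/2)"] GF[of "1/2"] by simp
  qed
  have F1: "cmod (F z) < 1" if "cmod z < 1" for z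
    using Fle[OF that] that by simp
  have "\<exists>z. cmod z < 1 \<and> z \<noteq> 0 \<and> cmod (F z) = cmod z"
    using Feq by (intro exI[of _ "1/2"]) simp
  then have "\<exists>\<alpha>. (\<forall>z. cmod z < 1 \<longrightarrow> F z = \<alpha> * z) \<and> cmod \<alpha> = 1"
    using Schwarz_Lemma(3)[OF holF F0 F1, of 0] by simp
  then obtain c where c: "cmod c = 1" "\<And>z. cmod z < 1 \<Longrightarrow> F z = c * z"
    by blast
  have "\<phi> z = disk_moebius c a z" if "z \<in> ball 0 1" for z
  proof -
    have "\<phi> z = F (n z)"
      using mn that by (simp add: F_def)
    also have "\<dots> = c * n z"
      using nin[OF that] by (intro c) simp
    finally show ?thesis
      by (simp add: n_def disk_moebius_def)
  qed
  with c a show ?thesis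
    using that by blast
qed

text \<open>This is \<open>|\<psi>'|\<^sup>s\<^sup>+\<^sup>2\<close> for every automorphism \<open>\<psi>\<close> of the disk with \<open>\<psi> a = 0\<close>, that is, the
  factor by which \<open>\<psi>\<close> distorts the weighted area measure: \<open>1 - |\<psi>|\<^sup>2 = (1 - |z|\<^sup>2) |\<psi>'|\<close>.\<close>

definition boundary_weight :: "real \<Rightarrow> complex \<Rightarrow> complex \<Rightarrow> real" where
  "boundary_weight s a z = ((1 - (cmod a)\<^sup>2) / (cmod (1 - cnj a * z))\<^sup>2) powr (s + 2)"

text \<open>The denominator does not vanish even on the unit circle. Continuity on the closed disk
  is essential, since the weight will be compared with its value at a boundary point.\<close>

lemma continuous_boundary_weight:
  assumes "cmod a < 1"
  shows "continuous_on (cball 0 1) (boundary_weight s a)"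
proof -
  have "1 - (cmod a)\<^sup>2 \<noteq> 0"
    using assms abs_square_less_1[of "cmod a"] by simp
  then show ?thesis
    unfolding boundary_weight_def[abs_def]
    using one_minus_cnj_mult_nonzero[OF assms] by (intro continuous_intros) auto
qed

lemma boundary_weight_nonneg: "0 \<le> boundary_weight s a z"
  by (simp add: boundary_weight_def)

lemma measurable_boundary_weight [measurable]: "boundary_weight s a \<in> borel_measurable borel"
  unfolding boundary_weight_def[abs_def] by measurable

lemma boundary_weight_bounded:
  assumes "cmod a < 1"
  obtains B where "\<And>z. z \<in> cball 0 1 \<Longrightarrow> boundary_weight s a z \<le> B"
proof -
  have "compact (boundary_weight s a ` cball 0 1)"
    by (rule compact_continuous_image[OF continuous_boundary_weight[OF assms] compact_cball])
  then have "bdd_above (boundary_weight s a ` cball 0 1)"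
    by (intro bounded_imp_bdd_above compact_imp_bounded)
  then obtain B where "\<And>x. x \<in> boundary_weight s a ` cball 0 1 \<Longrightarrow> x \<le> B"
    unfolding bdd_above_def by blast
  then show ?thesis
    using that by blast
qed

lemma AE_bergman_measure: "AE z in bergman_measure s. z \<in> ball 0 1"
  unfolding bergman_measure_def
  by (subst AE_density) (auto simp: indicator_def)

lemma integrable_mult_boundary_weight:
  assumes s: "s > -1" and a: "cmod a < 1" and h: "h \<in> A2 s"
  shows "integrable (bergman_measure s) (\<lambda>z. (cmod (h z))\<^sup>2 * boundary_weight s a z)"
proof -
  have [measurable]: "h \<in> borel_measurable borel"
    by (rule A2_measurable[OF h])
  obtain B where B: "\<And>z. z \<in> cball 0 1 \<Longrightarrow> boundary_weight s a z \<le> B"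
    using boundary_weight_bounded[OF a, of s] by blast
  show ?thesis
  proof (rule Bochner_Integration.integrable_bound)
    show "integrable (bergman_measure s) (\<lambda>z. B * (cmod (h z))\<^sup>2)"
      using A2_integrable[OF s h] by simp
    show "AE z in bergman_measure s. norm ((cmod (h z))\<^sup>2 * boundary_weight s a z)
        \<le> norm (B * (cmod (h z))\<^sup>2)"
      using AE_bergman_measure
    proof eventually_elim
      case (elim z)
      then have "boundary_weight s a z \<le> \<bar>B\<bar>"
        using B[of z] by auto
      then show ?case
        using mult_left_mono[of "boundary_weight s a z" "\<bar>B\<bar>" "(cmod (h z))\<^sup>2"]
        by (simp add: abs_mult boundary_weight_nonneg mult.commute[of "\<bar>B\<bar>"])
    qed
  qed measurable
qed

text \<open>Substitute \<open>z = \<psi> w\<close> with \<open>\<psi>\<close> the inverse of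
  \<open>\<phi>\<close>. The Jacobian contributes the square and the Bergman weight the
  \<open>s\<close>-th power of the modulus of \<open>\<psi>'\<close>, together the
  \<open>boundary_weight\<close> at the zero \<open>- c * a\<close> of
  \<open>\<psi>\<close>.\<close>

lemma
  assumes s: "s > -1" and c: "cmod c = 1" and a: "cmod a < 1" and h: "h \<in> A2 s"
    and \<phi>: "\<And>z. z \<in> ball 0 1 \<Longrightarrow> \<phi> z = disk_moebius c a z"
  shows bergman_norm2_comp_moebius: "bergman_norm2 s (comp_op \<phi> h)
      = (\<integral>z. (cmod (h z))\<^sup>2 * boundary_weight s (- c * a) z \<partial>bergman_measure s)"
    and comp_moebius_in_A2: "comp_op \<phi> h \<in> A2 s"
proof -
  have [measurable]: "h \<in> borel_measurable borel"
    by (rule A2_measurable[OF h])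
  define b where "b = - c * a"
  have b: "cmod b < 1"
    using a c by (simp add: b_def norm_mult)
  define \<psi> where "\<psi> = disk_moebius (cnj c) b"
  have cc: "c * cnj c = 1"
    using c by (simp add: complex_norm_square[symmetric])
  have \<psi>in: "\<psi> z \<in> ball 0 1" if "z \<in> ball 0 1" for z
    unfolding \<psi>_def using that b c by (intro disk_moebius_in_ball) auto
  have \<phi>in: "\<phi> z \<in> ball 0 1" if "z \<in> ball 0 1" for z
    unfolding \<phi>[OF that] using that a c by (intro disk_moebius_in_ball) auto
  have \<phi>\<psi>: "\<phi> (\<psi> z) = z" if "z \<in> ball 0 1" for z
  proof -
    have "- cnj c * b = a"
      using cc by (simp add: b_def mult_ac)
    then show ?thesis
      using disk_moebius_inverse[of "cnj c" b z] that b c \<phi>[OF \<psi>in[OF that]] by (simp add: \<psi>_def)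
  qed
  have \<psi>\<phi>: "\<psi> (\<phi> z) = z" if "z \<in> ball 0 1" for z
    using disk_moebius_inverse[of c a z] that a c by (simp add: \<phi> \<psi>_def b_def)
  have im: "\<psi> ` ball 0 1 = ball 0 1"
  proof (intro equalityI subsetI)
    fix w assume "w \<in> \<psi> ` ball 0 1"
    then show "w \<in> ball 0 1"
      using \<psi>in by blast
  next
    fix w :: complex assume "w \<in> ball 0 1"
    then show "w \<in> \<psi> ` ball 0 1"
      using \<psi>\<phi>[of w] \<phi>in[of w] by (intro image_eqI[of w \<psi> "\<phi> w"]) simp_all
  qed
  have inj: "inj_on \<psi> (ball 0 1)"
    using \<phi>\<psi> by (metis inj_onI)
  define \<psi>' where "\<psi>' = (\<lambda>z. cnj c * (1 - cnj b * b) / (1 - cnj b * z)\<^sup>2)"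
  define F where "F = (\<lambda>z. (cmod (h (\<phi> z)))\<^sup>2 * bergman_weight s z)"
  have der: "(\<psi> has_field_derivative \<psi>' z) (at z within ball 0 1)" if "z \<in> ball 0 1" for z
    unfolding \<psi>_def \<psi>'_def by (rule has_field_derivative_disk_moebius[OF b that])
  have hol\<phi>: "\<phi> holomorphic_on ball 0 1"
    by (rule holomorphic_transform[OF disk_moebius_holomorphic[OF a]]) (simp add: \<phi>)
  have holc: "comp_op \<phi> h holomorphic_on ball 0 1"
  proof -
    have "h \<circ> \<phi> holomorphic_on ball 0 1"
      using h \<phi>in by (intro holomorphic_on_compose_gen[OF hol\<phi>]) (auto simp: A2_def)
    then show ?thesis
      by (rule holomorphic_transform) (simp add: comp_op_def)
  qed
  have zero: "comp_op \<phi> h z = 0" if "z \<notin> ball 0 1" for z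
    using that by (simp add: comp_op_def)
  have cm: "comp_op \<phi> h \<in> borel_measurable borel"
    by (rule borel_measurable_holomorphic_vanishing[OF holc zero])
  have key: "(cmod (\<psi>' z))\<^sup>2 * F (\<psi> z) = bergman_weight s z * ((cmod (h z))\<^sup>2 * boundary_weight s b z)"
    if z: "z \<in> ball 0 1" for z
  proof -
    \<comment> \<open>\<open>d\<close> is the modulus of \<open>\<psi>'\<close> at
      \<open>z\<close>.\<close>
    define d where "d = (1 - (cmod b)\<^sup>2) / (cmod (1 - cnj b * z))\<^sup>2"
    have "d > 0"
      using b z one_minus_cnj_mult_nonzero[OF b, of z]
      by (auto simp: d_def abs_square_less_1)
    have "1 - cnj b * b = of_real (1 - (cmod b)\<^sup>2)"
      using complex_norm_square[of b] by (simp add: mult.commute)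
    moreover have "0 \<le> 1 - (cmod b)\<^sup>2"
      using b abs_square_less_1[of "cmod b"] by simp
    ultimately have "cmod (\<psi>' z) = d"
      using c by (simp add: \<psi>'_def d_def norm_mult norm_divide norm_power del: of_real_diff)
    moreover have "bergman_weight s (\<psi> z) = bergman_weight s z * d powr s"
      using one_minus_norm_disk_moebius[of "cnj c" b z] b c z \<open>d > 0\<close>
      by (simp add: bergman_weight_def \<psi>_def d_def[symmetric] powr_mult)
    moreover have "d\<^sup>2 * d powr s = boundary_weight s b z"
      using \<open>d > 0\<close> by (simp add: boundary_weight_def d_def[symmetric] powr_add)
    ultimately show ?thesis
      using \<phi>\<psi>[OF z] by (simp add: F_def mult_ac)
  qed
  \<comment> \<open>\<open>\<phi>\<close> is arbitrary outside the disk, so \<open>F\<close> need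
    not be measurable. Rewriting its cut-off through \<open>comp_op\<close>, which vanishes there,
    gives measurability.\<close>
  have ind1: "(\<lambda>z. indicator (\<psi> ` ball 0 1) z * F z)
      = (\<lambda>z. indicator (ball 0 1) z * bergman_weight s z * (cmod (comp_op \<phi> h z))\<^sup>2)"
    by (auto simp: im F_def comp_op_def indicator_def fun_eq_iff)
  have ind2: "(\<lambda>z. indicator (ball 0 1) z * ((cmod (\<psi>' z))\<^sup>2 * F (\<psi> z)))
      = (\<lambda>z. (indicator (ball 0 1) z * bergman_weight s z) * ((cmod (h z))\<^sup>2 * boundary_weight s b z))"
    by (auto simp: key indicator_def fun_eq_iff)
  have m1: "(\<lambda>z. indicator (\<psi> ` ball 0 1) z * F z) \<in> borel_measurable borel"
    unfolding ind1 by (rule borel_measurable_times[OF borel_measurable_bergman_density]) (use cm in measurable)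
  have m2: "(\<lambda>z. indicator (ball 0 1) z * ((cmod (\<psi>' z))\<^sup>2 * F (\<psi> z))) \<in> borel_measurable borel"
    unfolding ind2 by (rule borel_measurable_times[OF borel_measurable_bergman_density]) measurable
  have i2: "set_integrable lborel (ball 0 1) (\<lambda>z. (cmod (\<psi>' z))\<^sup>2 * F (\<psi> z))"
  proof -
    have "set_integrable lborel (ball 0 1) (\<lambda>z. bergman_weight s z *\<^sub>R ((cmod (h z))\<^sup>2 * boundary_weight s b z))"
      using integrable_mult_boundary_weight[OF s b h] by (subst integrable_bergman_measure_iff[OF s, symmetric]) measurable
    then show ?thesis
      by (subst set_integrable_cong[OF refl refl key]) auto
  qed
  note cov = has_integral_change_of_variables_holomorphic[of "ball 0 1" \<psi> \<psi>' F, OF _ der inj m1 m2 i2]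
  have "set_integrable lborel (ball 0 1) F"
    using cov(1) by (simp add: im)
  then have "set_integrable lborel (ball 0 1) (\<lambda>z. (cmod (comp_op \<phi> h z))\<^sup>2 * bergman_weight s z)"
    by (rule iffD1[OF set_integrable_cong[OF refl refl], rotated]) (simp add: F_def comp_op_def)
  then show "comp_op \<phi> h \<in> A2 s"
    using holc zero by (auto simp: A2_def)
  have "bergman_norm2 s (comp_op \<phi> h) = (LINT z:ball 0 1|lborel. F z)"
    unfolding bergman_norm2_def
    by (rule set_lebesgue_integral_cong) (auto simp: F_def comp_op_def)
  also have "\<dots> = (LINT z:ball 0 1|lborel. (cmod (\<psi>' z))\<^sup>2 * F (\<psi> z))"
    using cov(2) by (simp add: im)
  also have "\<dots> = (LINT z:ball 0 1|lborel. bergman_weight s z *\<^sub>R ((cmod (h z))\<^sup>2 * boundary_weight s b z))"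
    by (rule set_lebesgue_integral_cong) (auto simp: key)
  also have "\<dots> = (\<integral>z. (cmod (h z))\<^sup>2 * boundary_weight s b z \<partial>bergman_measure s)"
    by (rule integral_bergman_measure[OF s, symmetric]) measurable
  finally show "bergman_norm2 s (comp_op \<phi> h)
      = (\<integral>z. (cmod (h z))\<^sup>2 * boundary_weight s (- c * a) z \<partial>bergman_measure s)"
    by (simp add: b_def)
qed

subsection \<open>Concentration at a boundary point\<close>

definition peak :: "complex \<Rightarrow> nat \<Rightarrow> complex \<Rightarrow> complex" where
  "peak \<zeta> n z = (if z \<in> ball 0 1 then ((1 + cnj \<zeta> * z) / 2) ^ n else 0)"

lemma norm_one_plus_cnj_mult:
  assumes "cmod \<zeta> = 1"
  shows "cmod (1 + cnj \<zeta> * z) = cmod (\<zeta> + z)"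
proof -
  have "1 + cnj \<zeta> * z = cnj \<zeta> * (\<zeta> + z)"
    using assms complex_norm_square[of \<zeta>] by (simp add: ring_distribs mult.commute)
  then show ?thesis
    using assms by (simp add: norm_mult)
qed

lemma norm_peak_power2:
  assumes "cmod \<zeta> = 1" "z \<in> ball 0 1"
  shows "(cmod (peak \<zeta> n z))\<^sup>2 = ((cmod (\<zeta> + z))\<^sup>2 / 4) ^ n"
proof -
  have "(cmod (peak \<zeta> n z))\<^sup>2 = ((cmod ((1 + cnj \<zeta> * z) / 2))\<^sup>2) ^ n"
    using assms by (simp add: peak_def norm_power power_mult[symmetric] mult.commute)
  then show ?thesis
    using assms by (simp add: norm_divide norm_one_plus_cnj_mult power_divide)
qed

text \<open>Parallelogram law with \<open>cmod z \<le> 1\<close>. It quantifies how fast the peak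
  function drops below modulus 1 away from \<open>\<zeta>\<close>.\<close>

lemma norm_add_power2_le:
  assumes "cmod \<zeta> = 1" "z \<in> ball 0 1"
  shows "(cmod (\<zeta> + z))\<^sup>2 / 4 \<le> 1 - (dist \<zeta> z)\<^sup>2 / 4"
proof -
  have "(cmod (\<zeta> + z))\<^sup>2 + (dist \<zeta> z)\<^sup>2 = 2 * (cmod \<zeta>)\<^sup>2 + 2 * (cmod z)\<^sup>2"
    unfolding cmod_power2 dist_norm by (simp add: power2_eq_square algebra_simps)
  moreover have "(cmod z)\<^sup>2 \<le> 1"
    using assms by (simp add: abs_square_le_1)
  ultimately show ?thesis
    using assms by simp
qed

lemma peak_in_A2:
  assumes "s > -1" "cmod \<zeta> = 1"
  shows "peak \<zeta> n \<in> A2 s"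
proof (rule A2_bounded[OF assms(1)])
  have "(\<lambda>z. ((1 + cnj \<zeta> * z) / 2) ^ n) holomorphic_on ball 0 1"
    by (intro holomorphic_intros) auto
  then show "peak \<zeta> n holomorphic_on ball 0 1"
    by (rule holomorphic_transform) (simp add: peak_def)
  show "peak \<zeta> n z = 0" if "z \<notin> ball 0 1" for z
    using that by (simp add: peak_def)
  show "cmod (peak \<zeta> n z) \<le> 1" if z: "z \<in> ball 0 1" for z
  proof -
    have "(cmod (\<zeta> + z))\<^sup>2 / 4 \<le> 1"
      using norm_add_power2_le[OF assms(2) z] by (rule order_trans) simp
    then have "(cmod (peak \<zeta> n z))\<^sup>2 \<le> 1"
      unfolding norm_peak_power2[OF assms(2) z] by (intro power_le_one) auto
    then show ?thesis
      by (simp add: abs_square_le_1)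
  qed
qed

text \<open>Within distance \<open>\<eta>\<close> of \<open>\<zeta>\<close> one has
  \<open>cmod (\<zeta> + z) \<ge> 2 - \<eta>\<close>, so the squared peak function is at least
  \<open>1 - \<eta>\<close>; \<open>m\<close> is the measure of that part of the disk. The norms
  thus decay more slowly than any geometric rate fixed in advance.\<close>

lemma peak_norm_lower_bound:
  assumes s: "s > -1" and \<zeta>: "cmod \<zeta> = 1" and \<eta>: "0 < \<eta>" "\<eta> < 1"
  shows "\<exists>m>0. \<forall>n. m * (1 - \<eta>) ^ n \<le> bergman_norm2 s (peak \<zeta> n)"
proof -
  interpret finite_measure "bergman_measure s"
    by (rule finite_measure_bergman[OF s])
  let ?U = "ball 0 1 \<inter> ball \<zeta> \<eta>"
  \<comment> \<open>This point, at distance \<open>\<eta> / 2\<close> from \<open>\<zeta>\<close>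
    along the radius, witnesses that the two balls meet.\<close>
  have "of_real (1 - \<eta> / 2) * \<zeta> \<in> ball 0 1"
    using \<zeta> \<eta> by (simp add: norm_mult del: of_real_diff)
  moreover have "of_real (1 - \<eta> / 2) * \<zeta> \<in> ball \<zeta> \<eta>"
  proof -
    have "\<zeta> - of_real (1 - \<eta> / 2) * \<zeta> = of_real (\<eta> / 2) * \<zeta>"
      by (simp add: algebra_simps)
    then show ?thesis
      using \<zeta> \<eta> by (simp only: mem_ball dist_norm norm_mult) simp
  qed
  ultimately have ne: "?U \<noteq> {}"
    by blast
  have "0 < measure (bergman_measure s) ?U"
    by (rule measure_bergman_pos[OF s open_Int[OF open_ball open_ball] ne Int_lower1])
  moreover have "measure (bergman_measure s) ?U * (1 - \<eta>) ^ n \<le> bergman_norm2 s (peak \<zeta> n)" for n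
  proof -
    have "measure (bergman_measure s) ?U * (1 - \<eta>) ^ n
        = (\<integral>z. indicator ?U z * (1 - \<eta>) ^ n \<partial>bergman_measure s)"
      by simp
    also have "\<dots> \<le> (\<integral>z. (cmod (peak \<zeta> n z))\<^sup>2 \<partial>bergman_measure s)"
    proof (rule integral_mono)
      show "integrable (bergman_measure s) (\<lambda>z. indicator ?U z * (1 - \<eta>) ^ n)"
        by (intro integrable_mult_left integrable_real_indicator) (auto simp: emeasure_finite less_top[symmetric])
      show "integrable (bergman_measure s) (\<lambda>z. (cmod (peak \<zeta> n z))\<^sup>2)"
        by (rule A2_integrable[OF s peak_in_A2[OF s \<zeta>]])
      fix z
      show "indicator ?U z * (1 - \<eta>) ^ n \<le> (cmod (peak \<zeta> n z))\<^sup>2"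
      proof (cases "z \<in> ?U")
        case True
        then have z: "z \<in> ball 0 1" "cmod (\<zeta> - z) < \<eta>"
          by (auto simp: dist_norm)
        have "cmod (2 * \<zeta>) \<le> cmod (\<zeta> + z) + cmod (\<zeta> - z)"
          using norm_triangle_ineq[of "\<zeta> + z" "\<zeta> - z"] by simp
        then have "2 - \<eta> \<le> cmod (\<zeta> + z)"
          using \<zeta> z(2) unfolding norm_mult by simp
        then have "(2 - \<eta>)\<^sup>2 \<le> (cmod (\<zeta> + z))\<^sup>2"
          using \<eta> by (intro power_mono) auto
        then have "4 + \<eta>\<^sup>2 - 4 * \<eta> \<le> (cmod (\<zeta> + z))\<^sup>2"
          by (simp add: power2_diff)
        then have "1 - \<eta> \<le> (cmod (\<zeta> + z))\<^sup>2 / 4"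
          using zero_le_power2[of \<eta>] by linarith
        then show ?thesis
          unfolding norm_peak_power2[OF \<zeta> z(1)] using \<eta> True
          by (simp add: power_mono)
      next
        case False
        then show ?thesis
          by simp
      qed
    qed
    finally show ?thesis
      by (simp add: bergman_norm2_eq[OF s peak_in_A2[OF s \<zeta>]])
  qed
  ultimately show ?thesis
    by blast
qed

definition npeak :: "real \<Rightarrow> complex \<Rightarrow> nat \<Rightarrow> complex \<Rightarrow> complex" where
  "npeak s \<zeta> n z = of_real (inverse (sqrt (bergman_norm2 s (peak \<zeta> n)))) * peak \<zeta> n z"

lemma bergman_norm2_peak_pos:
  assumes "s > -1" "cmod \<zeta> = 1"
  shows "0 < bergman_norm2 s (peak \<zeta> n)"
proof -
  have "\<exists>m>0. \<forall>n. m * (1 - 1/2) ^ n \<le> bergman_norm2 s (peak \<zeta> n)"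
    by (rule peak_norm_lower_bound[OF assms]) simp_all
  then obtain m where m: "m > 0" "m * (1 - 1/2) ^ n \<le> bergman_norm2 s (peak \<zeta> n)"
    by blast
  have "0 < m * (1 - 1/2) ^ n"
    using m(1) by simp
  then show ?thesis
    using m(2) by (rule less_le_trans)
qed

lemma norm_npeak_power2:
  assumes "s > -1" "cmod \<zeta> = 1"
  shows "(cmod (npeak s \<zeta> n z))\<^sup>2 = (cmod (peak \<zeta> n z))\<^sup>2 / bergman_norm2 s (peak \<zeta> n)"
  using bergman_norm2_peak_pos[OF assms, of n]
  unfolding npeak_def norm_mult norm_of_real
  by (simp add: power_mult_distrib power_inverse divide_inverse)

lemma npeak_in_A2:
  assumes "s > -1" "cmod \<zeta> = 1"
  shows "npeak s \<zeta> n \<in> A2 s"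
proof (rule A2_I[OF assms(1)])
  have "peak \<zeta> n holomorphic_on ball 0 1"
    using peak_in_A2[OF assms, of n] by (simp add: A2_def)
  then show "npeak s \<zeta> n holomorphic_on ball 0 1"
    unfolding npeak_def[abs_def] by (intro holomorphic_intros)
  show "npeak s \<zeta> n z = 0" if "z \<notin> ball 0 1" for z
    using that by (simp add: npeak_def peak_def)
  show "integrable (bergman_measure s) (\<lambda>z. (cmod (npeak s \<zeta> n z))\<^sup>2)"
    using A2_integrable[OF assms(1) peak_in_A2[OF assms, of n]]
    by (simp add: norm_npeak_power2[OF assms])
qed

lemma bergman_norm2_npeak:
  assumes "s > -1" "cmod \<zeta> = 1"
  shows "bergman_norm2 s (npeak s \<zeta> n) = 1"
  using bergman_norm2_peak_pos[OF assms, of n]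
  by (simp add: bergman_norm2_eq[OF assms(1) npeak_in_A2[OF assms]] norm_npeak_power2[OF assms]
      bergman_norm2_eq[OF assms(1) peak_in_A2[OF assms], symmetric])

lemma integrable_mult_indicator_norm2:
  assumes "s > -1" "h \<in> A2 s" and [measurable]: "U \<in> sets borel"
  shows "integrable (bergman_measure s) (\<lambda>z. indicator U z * (cmod (h z))\<^sup>2)"
  using integrable_mult_indicator[OF _ A2_integrable[OF assms(1,2)], of U] by simp

text \<open>Off the ball the squared peak is at most \<open>r ^ n\<close>, while the lower bound
  with \<open>\<eta> = \<delta>\<^sup>2 / 8\<close> keeps the squared norm above
  \<open>m * r' ^ n\<close>. As \<open>r < r'\<close>, the quotient decays geometrically.\<close>

lemma npeak_concentrates:
  assumes s: "s > -1" and \<zeta>: "cmod \<zeta> = 1" and \<delta>: "0 < \<delta>" "\<delta> \<le> 1"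
  shows "(\<lambda>n. \<integral>z. indicator (- ball \<zeta> \<delta>) z * (cmod (npeak s \<zeta> n z))\<^sup>2 \<partial>bergman_measure s) \<longlonglongrightarrow> 0"
    (is "?t \<longlonglongrightarrow> 0")
proof -
  interpret finite_measure "bergman_measure s"
    by (rule finite_measure_bergman[OF s])
  define r where "r = 1 - \<delta>\<^sup>2 / 4"
  define r' where "r' = 1 - \<delta>\<^sup>2 / 8"
  let ?M = "measure (bergman_measure s) UNIV"
  have "\<delta>\<^sup>2 \<le> 1" "0 < \<delta>\<^sup>2"
    using \<delta> by (auto simp: abs_square_le_1)
  then have r: "0 < r" "r < r'" and \<eta>: "0 < \<delta>\<^sup>2 / 8" "\<delta>\<^sup>2 / 8 < 1"
    by (auto simp: r_def r'_def)
  obtain m where m: "m > 0" "\<And>n. m * r' ^ n \<le> bergman_norm2 s (peak \<zeta> n)"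
    using peak_norm_lower_bound[OF s \<zeta> \<eta>] unfolding r'_def by blast
  have bound: "?t n \<le> (?M / m) * (r / r') ^ n" for n
  proof -
    have "?t n \<le> (\<integral>z. r ^ n / (m * r' ^ n) \<partial>bergman_measure s)"
    proof (rule integral_mono_AE)
      show "integrable (bergman_measure s) (\<lambda>z. indicator (- ball \<zeta> \<delta>) z * (cmod (npeak s \<zeta> n z))\<^sup>2)"
        by (intro integrable_mult_indicator_norm2 s npeak_in_A2 \<zeta>) auto
      show "AE z in bergman_measure s. indicator (- ball \<zeta> \<delta>) z * (cmod (npeak s \<zeta> n z))\<^sup>2 \<le> r ^ n / (m * r' ^ n)"
        using AE_bergman_measure
      proof eventually_elim
        case (elim z)
        show ?case
        proof (cases "z \<in> ball \<zeta> \<delta>")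
          case True
          then show ?thesis
            using m r by simp
        next
          case False
          then have "\<delta>\<^sup>2 \<le> (dist \<zeta> z)\<^sup>2"
            using \<delta> by (intro power_mono) auto
          then have "(cmod (\<zeta> + z))\<^sup>2 / 4 \<le> r"
            using norm_add_power2_le[OF \<zeta> elim] by (simp add: r_def)
          then have "(cmod (peak \<zeta> n z))\<^sup>2 \<le> r ^ n"
            unfolding norm_peak_power2[OF \<zeta> elim] by (intro power_mono) auto
          then have "(cmod (npeak s \<zeta> n z))\<^sup>2 \<le> r ^ n / (m * r' ^ n)"
            unfolding norm_npeak_power2[OF s \<zeta>] using m r by (intro frac_le) auto
          then show ?thesis
            using False by simp
        qed
      qed
    qed simp
    also have "\<dots> = (?M / m) * (r / r') ^ n"
      by (simp add: power_divide)
    finally show ?thesis .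
  qed
  have "(\<lambda>n. (?M / m) * (r / r') ^ n) \<longlonglongrightarrow> 0"
    using r by (intro tendsto_mult_right_zero LIMSEQ_power_zero) simp
  moreover have "0 \<le> ?t n" for n
    by (intro Bochner_Integration.integral_nonneg) auto
  ultimately show ?thesis
    using bound by (intro real_tendsto_sandwich[of "\<lambda>_. 0" ?t]) auto
qed

text \<open>The unit mass of \<open>npeak\<close> gathers near \<open>\<zeta>\<close>, where
  \<open>D\<close> is close to \<open>D \<zeta>\<close>; the rest of the disk carries vanishing mass
  and \<open>D\<close> is bounded above there.\<close>

lemma integral_npeak_mult_less:
  assumes s: "s > -1" and \<zeta>: "cmod \<zeta> = 1" and [measurable]: "D \<in> borel_measurable borel"
    and cont: "continuous_on (cball 0 1) D" and less: "D \<zeta> < \<kappa>"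
    and int: "\<And>n. integrable (bergman_measure s) (\<lambda>z. (cmod (npeak s \<zeta> n z))\<^sup>2 * D z)"
  shows "eventually (\<lambda>n. (\<integral>z. (cmod (npeak s \<zeta> n z))\<^sup>2 * D z \<partial>bergman_measure s) < \<kappa>) sequentially"
proof -
  \<comment> \<open>The midpoint leaves room on both sides: continuity gives
    \<open>D \<le> \<kappa>0\<close> near \<open>\<zeta>\<close>, and the remainder has to stay
    below \<open>\<kappa> - \<kappa>0\<close>.\<close>
  define \<kappa>0 where "\<kappa>0 = (D \<zeta> + \<kappa>) / 2"
  have \<kappa>0: "D \<zeta> < \<kappa>0" "\<kappa>0 < \<kappa>"
    using less by (auto simp: \<kappa>0_def)
  have "\<zeta> \<in> cball 0 1" "0 < \<kappa>0 - D \<zeta>"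
    using \<zeta> \<kappa>0 by auto
  then obtain d where d: "d > 0" "\<And>z. z \<in> cball 0 1 \<Longrightarrow> dist z \<zeta> < d \<Longrightarrow> dist (D z) (D \<zeta>) < \<kappa>0 - D \<zeta>"
    using cont unfolding continuous_on_iff by blast
  define \<delta> where "\<delta> = min d 1"
  have \<delta>: "0 < \<delta>" "\<delta> \<le> 1"
    using d by (auto simp: \<delta>_def)
  have near: "D z \<le> \<kappa>0" if "z \<in> ball 0 1" "z \<in> ball \<zeta> \<delta>" for z
    using d(2)[of z] that by (auto simp: \<delta>_def dist_commute dist_real_def)
  have "bdd_above (D ` cball 0 1)"
    by (intro bounded_imp_bdd_above compact_imp_bounded compact_continuous_image cont compact_cball)
  then obtain B0 where B0: "\<And>z. z \<in> cball 0 1 \<Longrightarrow> D z \<le> B0"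
    unfolding bdd_above_def by blast
  define B where "B = \<bar>B0\<bar> + \<bar>\<kappa>0\<bar>"
  have B: "B \<ge> 0" "D z - \<kappa>0 \<le> B" if "z \<in> ball 0 1" for z
    using B0[of z] that unfolding B_def by auto
  let ?t = "\<lambda>n. \<integral>z. indicator (- ball \<zeta> \<delta>) z * (cmod (npeak s \<zeta> n z))\<^sup>2 \<partial>bergman_measure s"
  note A2 = npeak_in_A2[OF s \<zeta>]
  have bound: "(\<integral>z. (cmod (npeak s \<zeta> n z))\<^sup>2 * D z \<partial>bergman_measure s) \<le> \<kappa>0 + B * ?t n" for n
  proof -
    have i: "integrable (bergman_measure s) (\<lambda>z. indicator (- ball \<zeta> \<delta>) z * (cmod (npeak s \<zeta> n z))\<^sup>2)"
      by (intro integrable_mult_indicator_norm2 s A2) auto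
    have "(\<integral>z. (cmod (npeak s \<zeta> n z))\<^sup>2 * D z \<partial>bergman_measure s)
      \<le> (\<integral>z. \<kappa>0 * (cmod (npeak s \<zeta> n z))\<^sup>2
          + B * (indicator (- ball \<zeta> \<delta>) z * (cmod (npeak s \<zeta> n z))\<^sup>2) \<partial>bergman_measure s)"
    proof (rule integral_mono_AE[OF int])
      show "AE z in bergman_measure s. (cmod (npeak s \<zeta> n z))\<^sup>2 * D z
        \<le> \<kappa>0 * (cmod (npeak s \<zeta> n z))\<^sup>2 + B * (indicator (- ball \<zeta> \<delta>) z * (cmod (npeak s \<zeta> n z))\<^sup>2)"
        using AE_bergman_measure
      proof eventually_elim
        case (elim z)
        have "D z \<le> \<kappa>0 + B * indicator (- ball \<zeta> \<delta>) z"
          using near[OF elim] B[OF elim] by (cases "z \<in> ball \<zeta> \<delta>") (auto simp: algebra_simps)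
        then have "(cmod (npeak s \<zeta> n z))\<^sup>2 * D z
            \<le> (cmod (npeak s \<zeta> n z))\<^sup>2 * (\<kappa>0 + B * indicator (- ball \<zeta> \<delta>) z)"
          by (intro mult_left_mono) auto
        then show ?case
          by (simp only: distrib_left mult_ac) (simp only: distrib_right mult_ac)
      qed
    qed (use i A2_integrable[OF s A2] in simp)
    also have "\<dots> = \<kappa>0 * bergman_norm2 s (npeak s \<zeta> n) + B * ?t n"
      using i A2_integrable[OF s A2] by (simp add: bergman_norm2_eq[OF s A2])
    finally show ?thesis
      by (simp add: bergman_norm2_npeak[OF s \<zeta>])
  qed
  have "(\<lambda>n. \<kappa>0 + B * ?t n) \<longlonglongrightarrow> \<kappa>0 + B * 0"
    by (intro tendsto_intros npeak_concentrates s \<zeta> \<delta>)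
  then have "eventually (\<lambda>n. \<kappa>0 + B * ?t n < \<kappa>) sequentially"
    using \<kappa>0 by (intro order_tendstoD) auto
  then show ?thesis
    by eventually_elim (rule le_less_trans[OF bound])
qed

text \<open>Split the integral at a small ball about \<open>\<zeta>\<close> and apply Cauchy-Schwarz
  to each piece. Inside, \<open>h\<close> has little mass by dominated convergence; outside,
  \<open>npeak\<close> has little mass by concentration.\<close>

lemma npeak_weakly_null:
  assumes s: "s > -1" and \<zeta>: "cmod \<zeta> = 1" and h: "h \<in> A2 s"
  shows "(\<lambda>n. (cmod (bergman_inner s h (npeak s \<zeta> n)))\<^sup>2) \<longlonglongrightarrow> 0"
proof -
  note A2 = npeak_in_A2[OF s \<zeta>]
  have [measurable]: "h \<in> borel_measurable borel" "\<And>n. npeak s \<zeta> n \<in> borel_measurable borel"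
    by (rule A2_measurable[OF h], rule A2_measurable[OF A2])
  define \<delta> where "\<delta> k = inverse (real (Suc k))" for k
  have \<delta>: "0 < \<delta> k" "\<delta> k \<le> 1" for k
    by (auto simp: \<delta>_def inverse_le_1_iff)
  let ?H = "\<lambda>k. \<integral>z. indicator (ball \<zeta> (\<delta> k)) z * (cmod (h z))\<^sup>2 \<partial>bergman_measure s"
  let ?t = "\<lambda>k n. \<integral>z. indicator (- ball \<zeta> (\<delta> k)) z * (cmod (npeak s \<zeta> n z))\<^sup>2 \<partial>bergman_measure s"
  have H: "?H \<longlonglongrightarrow> (\<integral>z. 0 \<partial>bergman_measure s)"
  proof (rule integral_dominated_convergence[where w = "\<lambda>z. (cmod (h z))\<^sup>2"])
    show "AE z in bergman_measure s. (\<lambda>k. indicator (ball \<zeta> (\<delta> k)) z * (cmod (h z))\<^sup>2) \<longlonglongrightarrow> 0"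
    proof (rule AE_I2)
      fix z
      show "(\<lambda>k. indicator (ball \<zeta> (\<delta> k)) z * (cmod (h z))\<^sup>2) \<longlonglongrightarrow> 0"
      proof (cases "z = \<zeta>")
        case True
        \<comment> \<open>At \<open>\<zeta>\<close> itself the indicators never vanish, but elements
          of \<open>A2\<close> are 0 off the open disk.\<close>
        then have "h z = 0"
          using h \<zeta> by (simp add: A2_def)
        then show ?thesis
          by simp
      next
        case False
        have "\<delta> \<longlonglongrightarrow> 0"
          unfolding \<delta>_def by (rule LIMSEQ_inverse_real_of_nat)
        then have "eventually (\<lambda>k. \<delta> k < dist \<zeta> z) sequentially"
          using False by (intro order_tendstoD) auto
        then have "eventually (\<lambda>k. indicator (ball \<zeta> (\<delta> k)) z * (cmod (h z))\<^sup>2 = 0) sequentially"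
          by eventually_elim auto
        then show ?thesis
          by (rule tendsto_eventually)
      qed
    qed
    show "AE z in bergman_measure s. norm (indicator (ball \<zeta> (\<delta> k)) z * (cmod (h z))\<^sup>2) \<le> (cmod (h z))\<^sup>2" for k
      by (auto simp: indicator_def)
    show "(\<lambda>z. indicator (ball \<zeta> (\<delta> k)) z * (cmod (h z))\<^sup>2) \<in> borel_measurable (bergman_measure s)" for k
      by (rule borel_measurable_integrable[OF integrable_mult_indicator_norm2[OF s h]]) simp
  qed (use A2_integrable[OF s h] in auto)
  have bound: "(cmod (bergman_inner s h (npeak s \<zeta> n)))\<^sup>2 \<le> 2 * ?H k + 2 * (bergman_norm2 s h * ?t k n)" for k n
  proof -
    let ?U = "ball \<zeta> (\<delta> k)"
    let ?h1 = "\<lambda>z. indicator ?U z * h z" and ?g1 = "\<lambda>z. indicator (- ?U) z * npeak s \<zeta> n z"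
    have h1: "(cmod (?h1 z))\<^sup>2 = indicator ?U z * (cmod (h z))\<^sup>2"
      and g1: "(cmod (?g1 z))\<^sup>2 = indicator (- ?U) z * (cmod (npeak s \<zeta> n z))\<^sup>2" for z
      by (auto simp: indicator_def)
    have mh: "h \<in> borel_measurable (bergman_measure s)"
      and mg: "npeak s \<zeta> n \<in> borel_measurable (bergman_measure s)"
      by measurable
    have m: "?h1 \<in> borel_measurable (bergman_measure s)" "?g1 \<in> borel_measurable (bergman_measure s)"
      by (intro borel_measurable_times borel_measurable_indicator mh mg; simp)+
    have ih: "integrable (bergman_measure s) (\<lambda>z. (cmod (?h1 z))\<^sup>2)"
      and ig: "integrable (bergman_measure s) (\<lambda>z. (cmod (?g1 z))\<^sup>2)"
      unfolding h1 g1 by (intro integrable_mult_indicator_norm2 s h A2; simp)+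
    note jh = A2_integrable[OF s h] and jg = A2_integrable[OF s A2[of n]]
    let ?I = "\<integral>z. ?h1 z * cnj (npeak s \<zeta> n z) \<partial>bergman_measure s"
      and ?J = "\<integral>z. h z * cnj (?g1 z) \<partial>bergman_measure s"
    \<comment> \<open>The near cut-off is placed on \<open>h\<close> and the far one on
      \<open>npeak\<close>, so that each product contains one small factor.\<close>
    have "bergman_inner s h (npeak s \<zeta> n)
      = (\<integral>z. ?h1 z * cnj (npeak s \<zeta> n z) + h z * cnj (?g1 z) \<partial>bergman_measure s)"
      unfolding bergman_inner_eq[OF s h A2]
      by (intro Bochner_Integration.integral_cong) (auto simp: indicator_def)
    also have "\<dots> = ?I + ?J"
      by (intro Bochner_Integration.integral_add integrable_mult_cnj m mh mg ih ig jh jg)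
    finally have "(cmod (bergman_inner s h (npeak s \<zeta> n)))\<^sup>2 \<le> (cmod ?I + cmod ?J)\<^sup>2"
      by (simp add: norm_triangle_ineq power_mono)
    also have "\<dots> \<le> 2 * (cmod ?I)\<^sup>2 + 2 * (cmod ?J)\<^sup>2"
      using sum_squares_bound[of "cmod ?I" "cmod ?J"] by (simp add: power2_sum)
    also have "\<dots> \<le> 2 * ?H k + 2 * (bergman_norm2 s h * ?t k n)"
      using integral_mult_cnj_le[OF m(1) mg ih jg] integral_mult_cnj_le[OF mh m(2) jh ig]
      unfolding h1 g1 bergman_norm2_eq[OF s A2, symmetric] bergman_norm2_eq[OF s h, symmetric]
      by (simp add: bergman_norm2_npeak[OF s \<zeta>])
    finally show ?thesis .
  qed
  show ?thesis
  proof (rule LIMSEQ_I)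
    fix e :: real
    assume e: "e > 0"
    have "eventually (\<lambda>k. ?H k < e / 4) sequentially"
      using H e by (intro order_tendstoD) auto
    \<comment> \<open>The radius is fixed before \<open>n\<close> grows, since concentration is a
      statement about each fixed ball.\<close>
    then obtain k where k: "?H k < e / 4"
      by (auto simp: eventually_sequentially)
    have "(\<lambda>n. bergman_norm2 s h * ?t k n) \<longlonglongrightarrow> bergman_norm2 s h * 0"
      by (intro tendsto_intros npeak_concentrates s \<zeta> \<delta>)
    then have "eventually (\<lambda>n. bergman_norm2 s h * ?t k n < e / 4) sequentially"
      using e by (intro order_tendstoD) auto
    then have "eventually (\<lambda>n. norm ((cmod (bergman_inner s h (npeak s \<zeta> n)))\<^sup>2 - 0) < e) sequentially"
    proof eventually_elim
      case (elim n)
      then show ?case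
        using bound[of n k] k by simp
    qed
    then show "\<exists>no. \<forall>n\<ge>no. norm ((cmod (bergman_inner s h (npeak s \<zeta> n)))\<^sup>2 - 0) < e"
      by (simp add: eventually_sequentially)
  qed
qed

section \<open>A boundary point where both weights are below 1\<close>

lemma unimodular_obtuse_direction:
  assumes "cmod a = cmod b" "a \<noteq> 0"
  obtains \<zeta> where "cmod \<zeta> = 1" "Re (cnj a * \<zeta>) \<le> 0" "Re (cnj b * \<zeta>) \<le> 0"
proof (cases "a + b = 0")
  case True
  then have "b = - a"
    by (simp add: add_eq_0_iff)
  with assms show ?thesis
    by (intro that[of "\<i> * sgn a"]) (auto simp: norm_mult norm_sgn sgn_div_norm)
next
  case False
  \<comment> \<open>For vectors of equal length the sum makes an angle of at most
    \<open>pi/2\<close> with each, so the opposite unit vector serves. When the sum is 0, a vector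
    perpendicular to \<open>a\<close> was taken instead.\<close>
  have ab: "\<bar>Re (cnj a * b)\<bar> \<le> (cmod a)\<^sup>2"
    using abs_Re_le_cmod[of "cnj a * b"] assms by (simp add: norm_mult power2_eq_square)
  have self: "Re (cnj x * x) = (cmod x)\<^sup>2" for x
    unfolding cmod_power2 by (simp add: power2_eq_square)
  have "Re (cnj b * a) = Re (cnj a * b)"
    by (simp add: mult.commute)
  then have nonneg: "Re (cnj a * (a + b)) \<ge> 0" "Re (cnj b * (a + b)) \<ge> 0"
    using ab self[of a] self[of b] unfolding distrib_left plus_complex.sel assms(1) by linarith+
  have eq: "Re (cnj x * - sgn (a + b)) = - (Re (cnj x * (a + b)) / cmod (a + b))" for x
    by (simp add: sgn_div_norm divide_inverse algebra_simps)
  show ?thesis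
  proof (rule that[of "- sgn (a + b)"])
    show "cmod (- sgn (a + b)) = 1"
      using False by (simp add: norm_sgn)
    show "Re (cnj a * - sgn (a + b)) \<le> 0" "Re (cnj b * - sgn (a + b)) \<le> 0"
      unfolding eq neg_le_0_iff_le using nonneg by (metis divide_nonneg_nonneg norm_ge_zero)+
  qed
qed

text \<open>The angle condition gives \<open>cmod (1 - cnj a * \<zeta>) \<ge> 1\<close>, so the base
  is at most \<open>1 - (cmod a)\<^sup>2\<close>, and the exponent \<open>s + 2\<close> is
  positive.\<close>

lemma boundary_weight_less_one:
  assumes s: "s > -1" and a: "cmod a < 1" "a \<noteq> 0" and \<zeta>: "cmod \<zeta> = 1" "Re (cnj a * \<zeta>) \<le> 0"
  shows "boundary_weight s a \<zeta> < 1"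
proof -
  have "(cmod (1 - cnj a * \<zeta>))\<^sup>2 = 1 - 2 * Re (cnj a * \<zeta>) + (cmod (cnj a * \<zeta>))\<^sup>2"
    unfolding cmod_power2 by (simp add: power2_eq_square algebra_simps)
  then have ge: "1 \<le> (cmod (1 - cnj a * \<zeta>))\<^sup>2"
    using \<zeta>(2) zero_le_power2[of "cmod (cnj a * \<zeta>)"] by linarith
  have pos: "0 < 1 - (cmod a)\<^sup>2" and less: "1 - (cmod a)\<^sup>2 < 1"
    using a by (auto simp: abs_square_less_1)
  have "(1 - (cmod a)\<^sup>2) / (cmod (1 - cnj a * \<zeta>))\<^sup>2 \<le> (1 - (cmod a)\<^sup>2) / 1"
    using pos ge by (intro divide_left_mono) auto
  also have "\<dots> < 1"
    using less by simp
  finally have "(1 - (cmod a)\<^sup>2) / (cmod (1 - cnj a * \<zeta>))\<^sup>2 < 1" .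
  moreover have "0 \<le> (1 - (cmod a)\<^sup>2) / (cmod (1 - cnj a * \<zeta>))\<^sup>2"
    using pos by (intro divide_nonneg_nonneg) auto
  ultimately show ?thesis
    unfolding boundary_weight_def using powr_less_mono2[of "s + 2" _ 1] s by simp
qed

subsection \<open>Essential normality\<close>

theorem theorem2p4:
  fixes s :: real and \<phi> :: "complex \<Rightarrow> complex"
  assumes "s > -1"
    and "disk_automorphism \<phi>"
    and "\<not> (\<exists>c. cmod c = 1 \<and> (\<forall>z\<in>ball 0 1. \<phi> z = c * z))"
  shows "\<not> essentially_normal s (comp_op \<phi>)"
proof
  note s = assms(1)
  define T where "T = comp_op \<phi>"
  assume "essentially_normal s (comp_op \<phi>)"
  then obtain S where bT: "bounded_op s T" and adj: "is_adjoint s T S"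
    and comp: "compact_op s (\<lambda>f. S (T f) - T (S f))"
    unfolding essentially_normal_def T_def by blast
  have T: "T f \<in> A2 s" if "f \<in> A2 s" for f
    using bT that by (simp add: bounded_op_def)
  have S: "S f \<in> A2 s" if "f \<in> A2 s" for f
    using adj that by (simp add: is_adjoint_def)
  have TS: "bergman_inner s (T f) g = bergman_inner s f (S g)" if "f \<in> A2 s" "g \<in> A2 s" for f g
    using adj that by (simp add: is_adjoint_def)
  obtain c b where c: "cmod c = 1" and b: "cmod b < 1"
    and \<phi>: "\<And>z. z \<in> ball 0 1 \<Longrightarrow> \<phi> z = disk_moebius c b z"
    using disk_automorphism_eq_moebius[OF assms(2)] by blast
  \<comment> \<open>With \<open>b = 0\<close> the Moebius form would be the rotation by
    \<open>c\<close>.\<close>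
  have "b \<noteq> 0"
    using assms(3) c \<phi> by (auto simp: disk_moebius_def)
  \<comment> \<open>\<open>a\<close> is the image of 0 under \<open>\<phi>\<close>, hence the zero
    of its inverse.\<close>
  define a where "a = - c * b"
  have a: "cmod a < 1" "a \<noteq> 0" "cmod a = cmod b"
    using b c \<open>b \<noteq> 0\<close> by (auto simp: a_def norm_mult)
  have ba: "- cnj c * a = b"
    using c complex_norm_square[of c] by (simp add: a_def mult_ac)
  \<comment> \<open>Composition with the inverse of \<open>\<phi>\<close>.\<close>
  define R where "R = comp_op (disk_moebius (cnj c) a)"
  obtain \<zeta> where \<zeta>: "cmod \<zeta> = 1" "Re (cnj a * \<zeta>) \<le> 0" "Re (cnj b * \<zeta>) \<le> 0"
    using unimodular_obtuse_direction[OF a(3,2)] .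
  define g where "g = npeak s \<zeta>"
  have g: "g n \<in> A2 s" for n
    unfolding g_def by (rule npeak_in_A2[OF s \<zeta>(1)])
  have ng: "bergman_norm2 s (g n) = 1" for n
    unfolding g_def by (rule bergman_norm2_npeak[OF s \<zeta>(1)])
  have less1: "boundary_weight s a \<zeta> < 1" "boundary_weight s b \<zeta> < 1"
    using boundary_weight_less_one s a b \<open>b \<noteq> 0\<close> \<zeta> by auto
  \<comment> \<open>A common strict bound for both weights at \<open>\<zeta>\<close>, halfway
    between the larger one and 1.\<close>
  define \<kappa> where "\<kappa> = (1 + max (boundary_weight s a \<zeta>) (boundary_weight s b \<zeta>)) / 2"
  have \<kappa>: "boundary_weight s a \<zeta> < \<kappa>" "boundary_weight s b \<zeta> < \<kappa>" "\<kappa> < 1"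
    using less1 by (auto simp: \<kappa>_def)
  have "cmod (cnj c) = 1"
    using c by simp
  have R: "R (g n) \<in> A2 s" for n
    unfolding R_def using comp_moebius_in_A2[OF s \<open>cmod (cnj c) = 1\<close> a(1) g] by blast
  \<comment> \<open>The weight belongs to the zero of the inverse map: \<open>a\<close> for
    \<open>T\<close>, and \<open>b\<close> for \<open>R\<close>.\<close>
  have normT: "bergman_norm2 s (T (g n))
      = (\<integral>z. (cmod (npeak s \<zeta> n z))\<^sup>2 * boundary_weight s a z \<partial>bergman_measure s)" for n
    using bergman_norm2_comp_moebius[OF s c b g \<phi>] by (simp add: T_def g_def a_def)
  have normR: "bergman_norm2 s (R (g n))
      = (\<integral>z. (cmod (npeak s \<zeta> n z))\<^sup>2 * boundary_weight s b z \<partial>bergman_measure s)" for n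
    using bergman_norm2_comp_moebius[OF s \<open>cmod (cnj c) = 1\<close> a(1) g refl, of n]
    unfolding ba by (simp add: R_def g_def)
  note less_\<kappa> = integral_npeak_mult_less[OF s \<zeta>(1) measurable_boundary_weight continuous_boundary_weight
      _ integrable_mult_boundary_weight[OF s _ npeak_in_A2[OF s \<zeta>(1)]]]
  have nT: "eventually (\<lambda>n. bergman_norm2 s (T (g n)) < \<kappa>) sequentially"
    unfolding normT by (rule less_\<kappa>[OF a(1) \<kappa>(1) a(1)])
  have nR: "eventually (\<lambda>n. bergman_norm2 s (R (g n)) < \<kappa>) sequentially"
    unfolding normR by (rule less_\<kappa>[OF b \<kappa>(2) b])
  have TR: "T (R (g n)) = g n" for n
  proof
    fix z
    show "T (R (g n)) z = g n z"
    proof (cases "z \<in> ball 0 1")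
      case True
      then show ?thesis
        using disk_moebius_inverse[OF c b True] disk_moebius_in_ball[OF c b True]
        by (simp add: T_def R_def comp_op_def \<phi> a_def del: mem_ball)
    next
      case False
      then show ?thesis
        using g[of n] by (simp add: T_def comp_op_def A2_def)
    qed
  qed
  let ?K = "\<lambda>f. S (T f) - T (S f)"
  have K: "?K (g n) \<in> A2 s" for n
    by (intro A2_diff s S T g)
  \<comment> \<open>The quadratic form of the self-commutator is the difference of the squared norms
    of \<open>T (g n)\<close> and of \<open>S (g n)\<close>.\<close>
  have innerK: "bergman_inner s (?K (g n)) (g n)
      = of_real (bergman_norm2 s (T (g n)) - bergman_norm2 s (S (g n)))" for n
  proof -
    have "bergman_inner s (S (T (g n))) (g n) = cnj (bergman_inner s (T (g n)) (T (g n)))"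
      using TS[OF g T[OF g]] bergman_inner_cnj by metis
    moreover have "bergman_inner s (T (S (g n))) (g n) = bergman_inner s (S (g n)) (S (g n))"
      by (intro TS S g)
    ultimately show ?thesis
      using bergman_inner_diff_left[OF s S[OF T[OF g]] T[OF S[OF g]] g]
      by (simp add: bergman_inner_self s S T g)
  qed
  have nn: "0 \<le> bergman_norm2 s f" if "f \<in> A2 s" for f
    using that by (simp add: bergman_norm2_eq s)
  have low: "eventually (\<lambda>n. (1 - \<kappa>)\<^sup>2 \<le> (cmod (bergman_inner s (?K (g n)) (g n)))\<^sup>2) sequentially"
    using nT nR
  proof eventually_elim
    case (elim n)
    \<comment> \<open>As \<open>T\<close> maps the short vector \<open>R (g n)\<close> to the unit vector \<open>g n\<close>, duality makes \<open>S (g n)\<close> long.\<close>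
    have "bergman_inner s (R (g n)) (S (g n)) = 1"
      using TS[OF R g, of n n] by (simp add: TR bergman_inner_self s g ng)
    then have "1 \<le> bergman_norm2 s (R (g n)) * bergman_norm2 s (S (g n))"
      using bergman_inner_le[OF s R S[OF g], of n n] by simp
    also have "\<dots> \<le> 1 * bergman_norm2 s (S (g n))"
      using elim \<kappa> by (intro mult_right_mono nn S g) simp
    finally have "1 - \<kappa> \<le> \<bar>bergman_norm2 s (T (g n)) - bergman_norm2 s (S (g n))\<bar>"
      using elim by linarith
    then have "1 - \<kappa> \<le> cmod (bergman_inner s (?K (g n)) (g n))"
      unfolding innerK norm_of_real .
    then show ?case
      using \<kappa> by (intro power_mono) auto
  qed
  have "\<exists>r h. strict_mono r \<and> h \<in> A2 s \<and> (\<lambda>n. bergman_norm2 s (?K (g (r n)) - h)) \<longlonglongrightarrow> 0"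
    using comp[unfolded compact_op_def, rule_format, of g] g ng by auto
  then obtain r h where r: "strict_mono r" and h: "h \<in> A2 s"
    and lim: "(\<lambda>n. bergman_norm2 s (?K (g (r n)) - h)) \<longlonglongrightarrow> 0"
    by blast
  \<comment> \<open>Along \<open>r\<close> the first term vanishes by compactness, the second
    because \<open>g\<close> tends weakly to 0.\<close>
  have up: "(cmod (bergman_inner s (?K (g n)) (g n)))\<^sup>2
      \<le> 2 * bergman_norm2 s (?K (g n) - h) + 2 * (cmod (bergman_inner s h (g n)))\<^sup>2" for n
  proof -
    let ?I = "bergman_inner s (?K (g n) - h) (g n)" and ?J = "bergman_inner s h (g n)"
    have "bergman_inner s (?K (g n)) (g n) = ?I + ?J"
      using bergman_inner_diff_left[OF s K h g] by simp
    then have "(cmod (bergman_inner s (?K (g n)) (g n)))\<^sup>2 \<le> (cmod ?I + cmod ?J)\<^sup>2"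
      by (simp add: norm_triangle_ineq power_mono)
    also have "\<dots> \<le> 2 * (cmod ?I)\<^sup>2 + 2 * (cmod ?J)\<^sup>2"
      using sum_squares_bound[of "cmod ?I" "cmod ?J"] by (simp add: power2_sum)
    also have "\<dots> \<le> 2 * bergman_norm2 s (?K (g n) - h) + 2 * (cmod ?J)\<^sup>2"
      using bergman_inner_le[OF s A2_diff[OF s K h] g, of n n] by (simp add: ng)
    finally show ?thesis .
  qed
  have "(\<lambda>n. (cmod (bergman_inner s h (g (r n))))\<^sup>2) \<longlonglongrightarrow> 0"
    using LIMSEQ_subseq_LIMSEQ[OF npeak_weakly_null[OF s \<zeta>(1) h] r] by (simp add: o_def g_def)
  with lim have "(\<lambda>n. 2 * bergman_norm2 s (?K (g (r n)) - h)
      + 2 * (cmod (bergman_inner s h (g (r n))))\<^sup>2) \<longlonglongrightarrow> 2 * 0 + 2 * 0"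
    by (intro tendsto_intros)
  moreover have "eventually (\<lambda>n. (1 - \<kappa>)\<^sup>2 \<le> (cmod (bergman_inner s (?K (g (r n))) (g (r n))))\<^sup>2) sequentially"
    by (rule eventually_subseq[OF r low])
  then have "eventually (\<lambda>n. (1 - \<kappa>)\<^sup>2 \<le> 2 * bergman_norm2 s (?K (g (r n)) - h)
      + 2 * (cmod (bergman_inner s h (g (r n))))\<^sup>2) sequentially"
    by eventually_elim (rule order_trans[OF _ up])
  \<comment> \<open>The lower bound passes to the limit and would force
    \<open>\<kappa> = 1\<close>.\<close>
  ultimately have "(1 - \<kappa>)\<^sup>2 \<le> 2 * 0 + 2 * 0"
    by (rule tendsto_lowerbound) simp
  with \<kappa> show False
    by simp
qed

end
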